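(* Let $I\subset\mathbb{R}$ be an open interval and fix $s_0\in I$. Let $\theta,\mu:I\to\mathbb{R}$ be two smooth functions such that $s_0$ is the only zero of $\theta$. Then there exists a unit speed spacelike curve $\gamma:I\to\mathbb{L}^3$ with non-zero curvature vector such that the causal curvature function and the pseudo-torsion function of $\gamma$ coincide on $I$ with $\theta$ and $\mu$, respectively. Moreover, such a curve is unique up to isometries of $\mathbb{L}^3$; that is, if $\gamma_1,\gamma_2$ are two such curves for the same $\theta,\mu$, then $\gamma_2=T\circ\gamma_1$ for some isometry $T$ of $\mathbb{L}^3$.
   Context: $\mathbb{L}^3$ is $\mathbb{R}^3$ with the inner product $\langle \boldsymbol{x},\boldsymbol{x}\rangle=x^2+y^2-z^2$ for $\boldsymbol{x}=(x,y,z)^T$. A vector $\boldsymbol{x}$ is spacelike if $\langle\boldsymbol{x},\boldsymbol{x}\rangle>0$ or $\boldsymbol{x}=\boldsymbol{0}$, timelike if $\langle\boldsymbol{x},\boldsymbol{x}\rangle<0$, and lightlike if $\boldsymbol{x}\neq\boldsymbol{0}$ and $\langle\boldsymbol{x},\boldsymbol{x}\rangle=0$. The vector product is $\boldsymbol{v}\times\boldsymbol{w}:=Z(\boldsymbol{v}\times_{\mathrm e}\boldsymbol{w})$, where $Z=\mathrm{diag}(1,1,-1)$ and $\times_{\mathrm e}$ is the standard Euclidean cross product. The isometry group of $\mathbb{L}^3$ is $\mathrm{O}(2,1)\ltimes\mathbb{L}^3$, where $\mathrm{O}(2,1)=\{A: A^TZA=Z\}$. All curves are smooth. A regular curve is spacelike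 if each of its tangent vectors is spacelike. For a unit speed spacelike curve $\gamma:I\to\mathbb{L}^3$ ($\langle\gamma',\gamma'\rangle=1$), set $\boldsymbol{e}:=\gamma'$, $\boldsymbol{\kappa}:=\gamma''$ (curvature vector field), and $\theta:=\langle\boldsymbol{\kappa},\boldsymbol{\kappa}\rangle$ (causal curvature function). The curve has non-zero curvature vector if $\boldsymbol{\kappa}$ vanishes nowhere. A point $s_0$ is curvature-lightlike if $\boldsymbol{\kappa}(s_0)$ is lightlike; then $\boldsymbol{e}(s_0)\times\boldsymbol{\kappa}(s_0)=\epsilon\,\boldsymbol{\kappa}(s_0)$ for some $\epsilon\in\{+1,-1\}$, called the sign and denoted $\mathrm{sgn}(\gamma,s_0)$. Let $s_0$ be a curvature-lightlike point, $\epsilon=\mathrm{sgn}(\gamma,s_0)$, and assume $s_0$ is the only curvature-lightlike point in an open interval $J\ni s_0$ (here $J=I$). The pseudo-binormal vector field $\boldsymbol{\beta}$ on $J$ is the (unique, smooth) vector field along $\gamma$ satisfying $\boldsymbol{e}\times\boldsymbol{\kappa}=\epsilon(\boldsymbol{\kappa}-\theta\boldsymbol{\beta})$; that is, $\boldsymbol{\beta}=\frac1\theta(\boldsymbol{\kappa}-\epsilon\,\boldsymbol{e}\times\boldsymbol{\kappa})$ on $J\setminus\{s_0\}$, extended smoothly to $s_0$. The pseudo-torsion function is $\mu:=-\langle\boldsymbol{\kappa}',\boldsymbol{\beta}\rangle$. *)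

theory Defs
  imports "HOL-Analysis.Analysis"
begin

section \<open>Lorentz--Minkowski 3-space\<close>

definition lorentz_inner :: "real^3 \<Rightarrow> real^3 \<Rightarrow> real"  (\<open>\<langle>_, _\<rangle>\<close>)
  where "\<langle>x, y\<rangle> = x$1 * y$1 + x$2 * y$2 - x$3 * y$3"

definition spacelike :: "real^3 \<Rightarrow> bool"
  where "spacelike x \<longleftrightarrow> \<langle>x, x\<rangle> > 0 \<or> x = 0"

definition lorentz_Z :: "real^3^3"
  where "lorentz_Z = (\<chi> i j. if i = j then (if i = 3 then - 1 else 1) else 0)"

definition lorentz_cross :: "real^3 \<Rightarrow> real^3 \<Rightarrow> real^3"
  where "lorentz_cross v w = lorentz_Z *v cross3 v w"

definition O21 :: "(real^3^3) set"
  where "O21 = {A. transpose A ** lorentz_Z ** A = lorentz_Z}"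

definition lorentz_isometry :: "(real^3 \<Rightarrow> real^3) \<Rightarrow> bool"
  where "lorentz_isometry T \<longleftrightarrow> (\<exists>A\<in>O21. \<exists>b. \<forall>x. T x = A *v x + b)"


section \<open>Smooth curves\<close>

abbreviation vderiv :: "(real \<Rightarrow> 'a::real_normed_vector) \<Rightarrow> real \<Rightarrow> 'a"
  where "vderiv f \<equiv> (\<lambda>s. vector_derivative f (at s))"

text \<open>Meant for open \<open>S\<close>: all derivatives are two-sided, so on an open \<open>S\<close> the condition,
  like everything below, only depends on the values of \<open>f\<close> on \<open>S\<close>.\<close>

definition smooth_on :: "real set \<Rightarrow> (real \<Rightarrow> 'a::real_normed_vector) \<Rightarrow> bool"
  where "smooth_on S f \<longleftrightarrow> (\<forall>n. \<forall>s\<in>S. (vderiv ^^ n) f differentiable at s)"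

definition spacelike_curve :: "real set \<Rightarrow> (real \<Rightarrow> real^3) \<Rightarrow> bool"
  where "spacelike_curve I \<gamma> \<longleftrightarrow>
    smooth_on I \<gamma> \<and> (\<forall>s\<in>I. vderiv \<gamma> s \<noteq> 0 \<and> spacelike (vderiv \<gamma> s))"

definition unit_speed :: "real set \<Rightarrow> (real \<Rightarrow> real^3) \<Rightarrow> bool"
  where "unit_speed I \<gamma> \<longleftrightarrow> (\<forall>s\<in>I. \<langle>vderiv \<gamma> s, vderiv \<gamma> s\<rangle> = 1)"

definition curvature_vector :: "(real \<Rightarrow> real^3) \<Rightarrow> real \<Rightarrow> real^3"
  where "curvature_vector \<gamma> = vderiv (vderiv \<gamma>)"

definition causal_curvature :: "(real \<Rightarrow> real^3) \<Rightarrow> real \<Rightarrow> real"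
  where "causal_curvature \<gamma> s = \<langle>curvature_vector \<gamma> s, curvature_vector \<gamma> s\<rangle>"

text \<open>The sign of a unit speed spacelike curve at a point where its curvature vector is
  lightlike; elsewhere the value is unspecified.\<close>

definition curvature_sign :: "(real \<Rightarrow> real^3) \<Rightarrow> real \<Rightarrow> real"
  where "curvature_sign \<gamma> s\<^sub>0 = (THE \<epsilon>. \<epsilon> \<in> {1, - 1} \<and>
    lorentz_cross (vderiv \<gamma> s\<^sub>0) (curvature_vector \<gamma> s\<^sub>0) = \<epsilon> *\<^sub>R curvature_vector \<gamma> s\<^sub>0)"

definition is_pseudo_binormal ::
    "real set \<Rightarrow> real \<Rightarrow> (real \<Rightarrow> real^3) \<Rightarrow> (real \<Rightarrow> real^3) \<Rightarrow> bool"
  where "is_pseudo_binormal J s\<^sub>0 \<gamma> \<beta> \<longleftrightarrow> smooth_on J \<beta> \<and>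
    (\<forall>s\<in>J. lorentz_cross (vderiv \<gamma> s) (curvature_vector \<gamma> s) =
      curvature_sign \<gamma> s\<^sub>0 *\<^sub>R (curvature_vector \<gamma> s - causal_curvature \<gamma> s *\<^sub>R \<beta> s))"

text \<open>If \<open>s\<^sub>0\<close> is the only curvature-lightlike point of \<open>\<gamma>\<close> in the open interval \<open>J\<close>, and the
  curvature vector vanishes nowhere on \<open>J\<close>, then such a field exists and its values on \<open>J\<close> are
  uniquely determined: away from \<open>s\<^sub>0\<close> by division by the causal curvature, at \<open>s\<^sub>0\<close> by
  continuity. The choice below thus only affects values outside \<open>J\<close>.\<close>

definition pseudo_binormal :: "real set \<Rightarrow> real \<Rightarrow> (real \<Rightarrow> real^3) \<Rightarrow> real \<Rightarrow> real^3"
  where "pseudo_binormal J s\<^sub>0 \<gamma> = (SOME \<beta>. is_pseudo_binormal J s\<^sub>0 \<gamma> \<beta>)"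

definition pseudo_torsion :: "real set \<Rightarrow> real \<Rightarrow> (real \<Rightarrow> real^3) \<Rightarrow> real \<Rightarrow> real"
  where "pseudo_torsion J s\<^sub>0 \<gamma> s =
    - \<langle>vderiv (curvature_vector \<gamma>) s, pseudo_binormal J s\<^sub>0 \<gamma> s\<rangle>"

definition curve_with_invariants ::
    "real set \<Rightarrow> real \<Rightarrow> (real \<Rightarrow> real) \<Rightarrow> (real \<Rightarrow> real) \<Rightarrow> (real \<Rightarrow> real^3) \<Rightarrow> bool"
  where "curve_with_invariants I s\<^sub>0 \<theta> \<mu> \<gamma> \<longleftrightarrow>
    spacelike_curve I \<gamma> \<and> unit_speed I \<gamma> \<and>
    (\<forall>s\<in>I. curvature_vector \<gamma> s \<noteq> 0) \<and>
    (\<forall>s\<in>I. causal_curvature \<gamma> s = \<theta> s) \<and>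
    (\<forall>s\<in>I. pseudo_torsion I s\<^sub>0 \<gamma> s = \<mu> s)"

end

theory Submission
  imports Defs
begin

text \<open>Along a curve with the given invariants, the velocity \<open>e\<close>, the curvature vector \<open>\<kappa>\<close> and the
  pseudo-binormal \<open>\<beta>\<close> form a frame whose Gram matrix depends only on \<open>\<theta>\<close>: the products that are not
  zero are \<open>\<langle>e, e\<rangle> = 1\<close>, \<open>\<langle>\<kappa>, \<beta>\<rangle> = 1\<close> and \<open>\<langle>\<kappa>, \<kappa>\<rangle> = \<theta>\<close>. Unlike the Frenet frame, it does not degenerate
  where \<open>\<theta>\<close> vanishes. Differentiating these relations gives the linear system \<open>e' = \<kappa>\<close>,
  \<open>\<kappa>' = - \<theta> e - \<mu> \<kappa> + (\<theta>' / 2 + \<mu> \<theta>) \<beta>\<close>, \<open>\<beta>' = - e + \<mu> \<beta>\<close>, whose coefficients are known functions.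

  For existence the system is solved with an initial frame having the right Gram matrix
  (\<open>linear_ode_solution_exists\<close>), and \<open>e\<close> is integrated to a curve. It remains to see that the Gram
  matrix stays right, and here one observation serves both halves of the theorem: for any two
  solutions, the linear map that takes the first frame to the second, written with the prescribed
  inverse Gram matrix, is constant (\<open>frame_transfer_constant\<close>). Comparing a solution with itself, the
  map is the identity initially, hence always, and this identity is equivalent to the six Gram
  relations (\<open>adapted_frame_iff_frame_transfer_id\<close>). Comparing the frames of two given curves, the
  constant map is the linear part of the isometry.

  The delicate point in the uniqueness half is that a given curve does possess a smooth
  pseudo-binormal, although \<open>\<theta>\<close> may vanish at \<open>s\<^sub>0\<close> to infinite order, so that the quotient
  \<open>(\<kappa> - \<epsilon> e \<times> \<kappa>) / \<theta>\<close> cannot be extended by comparing Taylor expansions. Instead, \<open>\<beta>\<close> is identified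
  geometrically: it is the null vector orthogonal to \<open>e\<close> that is not parallel to the nowhere
  vanishing null vector \<open>\<kappa> + \<epsilon> e \<times> \<kappa>\<close> and has product \<open>2\<close> with it. This gives a formula for \<open>\<beta>\<close> without
  division by \<open>\<theta>\<close> (\<open>null_companion\<close>).\<close>

section \<open>Smooth functions on open sets\<close>

text \<open>Smoothness of the solution of a differential equation is proved by induction on the number of
  available derivatives, so the finite stages of \<open>smooth_on\<close> are needed as notions of their own.
  The closure properties below go by induction on \<open>n\<close>: the derivative of the function in question
  is an expression in functions for which one derivative less is required.\<close>

definition times_differentiable_on :: "nat \<Rightarrow> real set \<Rightarrow> (real \<Rightarrow> 'a::real_normed_vector) \<Rightarrow> bool"
  where "times_differentiable_on n S f \<longleftrightarrow> (\<forall>k<n. \<forall>s\<in>S. (vderiv ^^ k) f differentiable at s)"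

lemma smooth_on_iff_times_differentiable_on:
  "smooth_on S f \<longleftrightarrow> (\<forall>n. times_differentiable_on n S f)"
  unfolding smooth_on_def times_differentiable_on_def by blast

lemma times_differentiable_on_0: "times_differentiable_on 0 S f"
  by (simp add: times_differentiable_on_def)

lemma times_differentiable_on_Suc:
  "times_differentiable_on (Suc n) S f \<longleftrightarrow>
     (\<forall>s\<in>S. f differentiable at s) \<and> times_differentiable_on n S (vderiv f)"
  unfolding times_differentiable_on_def
  by (auto simp: All_less_Suc2 funpow_Suc_right simp del: funpow.simps(2))

lemma times_differentiable_on_SucD:
  "times_differentiable_on (Suc n) S f \<Longrightarrow> times_differentiable_on n S f"
  by (simp add: times_differentiable_on_def)

lemma has_vector_derivative_vderiv:
  "f differentiable at s \<Longrightarrow> (f has_vector_derivative vderiv f s) (at s)"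
  by (simp add: vector_derivative_works)

lemma times_differentiable_on_cong:
  assumes "open S" "\<And>s. s \<in> S \<Longrightarrow> f s = g s" "times_differentiable_on n S f"
  shows "times_differentiable_on n S g"
  using assms(2,3)
proof (induction n arbitrary: f g)
  case 0
  show ?case by (rule times_differentiable_on_0)
next
  case (Suc n)
  have g: "(g has_vector_derivative vderiv f s) (at s)" if "s \<in> S" for s
  proof (rule has_vector_derivative_transform_within_open[OF _ assms(1) that Suc.prems(1)])
    show "(f has_vector_derivative vderiv f s) (at s)"
      using Suc.prems(2) that
      by (auto simp: times_differentiable_on_Suc intro: has_vector_derivative_vderiv)
  qed
  have "times_differentiable_on n S (vderiv g)"
  proof (rule Suc.IH)
    show "vderiv f s = vderiv g s" if "s \<in> S" for s
      using vector_derivative_at[OF g[OF that]] by simp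
    show "times_differentiable_on n S (vderiv f)"
      using Suc.prems(2) by (simp add: times_differentiable_on_Suc)
  qed
  then show ?case
    using differentiableI_vector[OF g] by (simp add: times_differentiable_on_Suc)
qed

lemma times_differentiable_on_SucI:
  assumes "open S" "\<And>s. s \<in> S \<Longrightarrow> (f has_vector_derivative f' s) (at s)"
    and "times_differentiable_on n S f'"
  shows "times_differentiable_on (Suc n) S f"
  unfolding times_differentiable_on_Suc
proof
  show "\<forall>s\<in>S. f differentiable at s"
    using differentiableI_vector[OF assms(2)] by blast
  show "times_differentiable_on n S (vderiv f)"
  proof (rule times_differentiable_on_cong[OF assms(1) _ assms(3)])
    show "f' s = vderiv f s" if "s \<in> S" for s
      using vector_derivative_at[OF assms(2)[OF that]] by simp
  qed
qed

lemma times_differentiable_on_const: "times_differentiable_on n S (\<lambda>s. c)"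
proof (induction n arbitrary: c)
  case (Suc n)
  then show ?case
    by (simp add: times_differentiable_on_Suc)
qed (rule times_differentiable_on_0)

lemma times_differentiable_on_add:
  assumes "open S" "times_differentiable_on n S f" "times_differentiable_on n S g"
  shows "times_differentiable_on n S (\<lambda>s. f s + g s)"
  using assms(2,3)
proof (induction n arbitrary: f g)
  case (Suc n)
  then have "times_differentiable_on n S (\<lambda>s. vderiv f s + vderiv g s)"
    by (simp add: times_differentiable_on_Suc)
  with Suc.prems show ?case
    by (intro times_differentiable_on_SucI[OF assms(1)])
      (auto simp: times_differentiable_on_Suc
        intro!: has_vector_derivative_add has_vector_derivative_vderiv)
qed (rule times_differentiable_on_0)

lemma times_differentiable_on_bilinear:
  assumes "open S" "bounded_bilinear B"
    and "times_differentiable_on n S f" "times_differentiable_on n S g"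
  shows "times_differentiable_on n S (\<lambda>s. B (f s) (g s))"
  using assms(3,4)
proof (induction n arbitrary: f g)
  case (Suc n)
  have "times_differentiable_on n S (\<lambda>s. B (f s) (vderiv g s) + B (vderiv f s) (g s))"
    using Suc.prems times_differentiable_on_SucD[OF Suc.prems(1)]
      times_differentiable_on_SucD[OF Suc.prems(2)]
    by (intro times_differentiable_on_add[OF assms(1)] Suc.IH)
      (auto simp: times_differentiable_on_Suc)
  with Suc.prems show ?case
    by (intro times_differentiable_on_SucI[OF assms(1)])
      (auto simp: times_differentiable_on_Suc
        intro!: bounded_bilinear.has_vector_derivative[OF assms(2)] has_vector_derivative_vderiv)
qed (rule times_differentiable_on_0)

text \<open>The derivative \<open>- f' / f\<^sup>2\<close> is a product of \<open>f'\<close> with copies of \<open>1 / f\<close> itself, so the induction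
  hypothesis for \<open>1 / f\<close> feeds the bilinear product rule.\<close>

lemma times_differentiable_on_inverse:
  fixes f :: "real \<Rightarrow> real"
  assumes "open S" "\<And>s. s \<in> S \<Longrightarrow> f s \<noteq> 0" "times_differentiable_on n S f"
  shows "times_differentiable_on n S (\<lambda>s. inverse (f s))"
  using assms(3)
proof (induction n)
  case (Suc n)
  let ?g = "\<lambda>s. inverse (f s)"
  have "times_differentiable_on n S ?g"
    using Suc.IH times_differentiable_on_SucD[OF Suc.prems] .
  then have "times_differentiable_on n S (\<lambda>s. - 1 * ((?g s * ?g s) * vderiv f s))"
    using Suc.prems
    by (intro times_differentiable_on_bilinear[OF assms(1) bounded_bilinear_mult]
        times_differentiable_on_const) (auto simp: times_differentiable_on_Suc)
  moreover have "(?g has_vector_derivative - 1 * ((?g s * ?g s) * vderiv f s)) (at s)"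
    if "s \<in> S" for s
  proof -
    have "(f has_real_derivative vderiv f s) (at s)"
      using Suc.prems that
      by (simp add: times_differentiable_on_Suc has_real_derivative_iff_has_vector_derivative
          has_vector_derivative_vderiv)
    from DERIV_inverse'[OF this assms(2)[OF that]] show ?thesis
      by (simp add: has_real_derivative_iff_has_vector_derivative mult_ac)
  qed
  ultimately show ?case
    by (intro times_differentiable_on_SucI[OF assms(1)])
qed (rule times_differentiable_on_0)

text \<open>If the derivative is as regular as the function, as for the two sides of a differential equation
  with smooth coefficients, each derivative produces the next one.\<close>

lemma smooth_onI_bootstrap:
  assumes "open S" "\<And>s. s \<in> S \<Longrightarrow> (f has_vector_derivative f' s) (at s)"
    and "\<And>n. times_differentiable_on n S f \<Longrightarrow> times_differentiable_on n S f'"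
  shows "smooth_on S f"
  unfolding smooth_on_iff_times_differentiable_on
proof
  fix n
  show "times_differentiable_on n S f"
  proof (induction n)
    case (Suc n)
    show ?case by (rule times_differentiable_on_SucI[OF assms(1,2) assms(3)[OF Suc.IH]])
  qed (rule times_differentiable_on_0)
qed

lemma smooth_on_const: "smooth_on S (\<lambda>s. c)"
  by (simp add: smooth_on_iff_times_differentiable_on times_differentiable_on_const)

lemma smooth_on_add:
  "open S \<Longrightarrow> smooth_on S f \<Longrightarrow> smooth_on S g \<Longrightarrow> smooth_on S (\<lambda>s. f s + g s)"
  by (simp add: smooth_on_iff_times_differentiable_on times_differentiable_on_add)

lemma smooth_on_bilinear:
  "open S \<Longrightarrow> bounded_bilinear B \<Longrightarrow> smooth_on S f \<Longrightarrow> smooth_on S g \<Longrightarrow>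
    smooth_on S (\<lambda>s. B (f s) (g s))"
  by (simp add: smooth_on_iff_times_differentiable_on times_differentiable_on_bilinear)

lemma smooth_on_inverse:
  fixes f :: "real \<Rightarrow> real"
  shows "open S \<Longrightarrow> (\<And>s. s \<in> S \<Longrightarrow> f s \<noteq> 0) \<Longrightarrow> smooth_on S f \<Longrightarrow> smooth_on S (\<lambda>s. inverse (f s))"
  by (simp add: smooth_on_iff_times_differentiable_on times_differentiable_on_inverse)

lemma smooth_on_scaleR:
  "open S \<Longrightarrow> smooth_on S c \<Longrightarrow> smooth_on S f \<Longrightarrow> smooth_on S (\<lambda>s. c s *\<^sub>R f s)"
  by (rule smooth_on_bilinear[OF _ bounded_bilinear_scaleR])

lemma smooth_on_bounded_linear:
  assumes "open S" "bounded_linear L" "smooth_on S f"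
  shows "smooth_on S (\<lambda>s. L (f s))"
proof -
  interpret L: bounded_linear L by fact
  have "bounded_bilinear (\<lambda>(x::real) y. x *\<^sub>R L y)"
    by (rule bounded_bilinear.comp[OF bounded_bilinear_scaleR bounded_linear_ident assms(2)])
  from smooth_on_bilinear[OF assms(1) this smooth_on_const[of S "1::real"] assms(3)]
  show ?thesis by simp
qed

lemma smooth_on_mult:
  fixes f g :: "real \<Rightarrow> real"
  shows "open S \<Longrightarrow> smooth_on S f \<Longrightarrow> smooth_on S g \<Longrightarrow> smooth_on S (\<lambda>s. f s * g s)"
  by (rule smooth_on_bilinear[OF _ bounded_bilinear_mult])

lemma smooth_on_vec_nth: "open S \<Longrightarrow> smooth_on S f \<Longrightarrow> smooth_on S (\<lambda>s. f s $ i)"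
  by (rule smooth_on_bounded_linear[OF _ bounded_linear_vec_nth])

lemma smooth_on_vderiv: "smooth_on S f \<Longrightarrow> smooth_on S (vderiv f)"
  unfolding smooth_on_iff_times_differentiable_on
  by (auto dest: spec[of _ "Suc _"] simp: times_differentiable_on_Suc)

lemma smooth_on_has_vector_derivative:
  "smooth_on S f \<Longrightarrow> s \<in> S \<Longrightarrow> (f has_vector_derivative vderiv f s) (at s)"
  by (rule has_vector_derivative_vderiv)
    (auto simp: smooth_on_iff_times_differentiable_on dest: spec[of _ 1]
      simp: times_differentiable_on_def)

lemma smooth_on_continuous_on: "smooth_on S f \<Longrightarrow> continuous_on S f"
  by (intro continuous_at_imp_continuous_on ballI
      has_vector_derivative_continuous[OF smooth_on_has_vector_derivative])

section \<open>Linear differential equations on an open interval\<close>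

text \<open>Estimates on the open interval \<open>I\<close> are made on compact subintervals. Each of them has to contain
  the base point \<open>c\<close>, where initial values are given, and to be a neighbourhood of the point \<open>t\<close> at
  which a two-sided derivative is wanted.\<close>

lemma two_points_inside_compact_interval:
  fixes I :: "real set"
  assumes "open I" "is_interval I" "c \<in> I" "t \<in> I"
  obtains a b where "a < c" "c < b" "a < t" "t < b" "{a..b} \<subseteq> I"
proof -
  have m: "min c t \<in> I" "max c t \<in> I" using assms by (auto simp: min_def max_def)
  obtain d where d: "d > 0" "cball (min c t) d \<subseteq> I"
    using assms(1) m(1) open_contains_cball by blast
  obtain e where e: "e > 0" "cball (max c t) e \<subseteq> I"
    using assms(1) m(2) open_contains_cball by blast
  have "min c t - d \<in> I" "max c t + e \<in> I"
    using d e by (auto simp: subset_iff dist_real_def)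
  then have "{min c t - d..max c t + e} \<subseteq> I"
    using mem_is_interval_1_I[OF assms(2)] by (meson atLeastAtMost_iff subsetI)
  with d(1) e(1) show thesis by (intro that) auto
qed

text \<open>The oriented integral from \<open>c\<close> to \<open>t\<close>: for \<open>t \<noteq> c\<close> one of the two intervals is empty, which gives
  the sign without a case distinction.\<close>

definition primitive_from :: "real \<Rightarrow> (real \<Rightarrow> 'a::banach) \<Rightarrow> real \<Rightarrow> 'a"
  where "primitive_from c f t = integral {c..t} f - integral {t..c} f"

lemma primitive_from_self: "primitive_from c f c = 0"
  by (simp add: primitive_from_def)

lemma has_vector_derivative_primitive_from:
  assumes "open I" "is_interval I" "c \<in> I" "continuous_on I f" "t \<in> I"
  shows "(primitive_from c f has_vector_derivative f t) (at t)"
proof -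
  obtain a b where ab: "a < c" "c < b" "a < t" "t < b" "{a..b} \<subseteq> I"
    using two_points_inside_compact_interval[OF assms(1-3,5)] .
  have cont: "continuous_on {a..b} f" using assms(4) ab(5) continuous_on_subset by blast
  then have int: "f integrable_on {a..x}" if "x \<le> b" for x
    using integrable_continuous_real continuous_on_subset that
    by (metis atLeastatMost_subset_iff order_refl)
  have eq: "integral {a..x} f - integral {a..c} f = primitive_from c f x" if "x \<in> {a<..<b}" for x
  proof (cases "c \<le> x")
    case True
    with Henstock_Kurzweil_Integration.integral_combine[where a = a and c = c and b = x and f = f] int ab that show ?thesis
      by (cases "x = c") (auto simp: primitive_from_def algebra_simps)
  next
    case False
    with Henstock_Kurzweil_Integration.integral_combine[where a = a and c = x and b = c and f = f] int ab that show ?thesis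
      by (auto simp: primitive_from_def algebra_simps)
  qed
  have "((\<lambda>u. integral {a..u} f) has_vector_derivative f t) (at t)"
    using integral_has_vector_derivative[OF cont, of t] ab at_within_Icc_at[of a t b] by auto
  then have "((\<lambda>u. integral {a..u} f - integral {a..c} f) has_vector_derivative f t) (at t)"
    using has_vector_derivative_diff[OF _ has_vector_derivative_const] by fastforce
  then show ?thesis
    using has_vector_derivative_transform_within_open[OF _ open_greaterThanLessThan _ eq] ab by auto
qed

text \<open>The estimate behind the Picard series. It is stated on the unit interval with one-sided growth:
  the general case is reduced to it by moving along the segment from the base point to the point
  in question, which treats points on both sides of the base point alike.\<close>

lemma iterated_primitive_bound:
  fixes w :: "nat \<Rightarrow> real \<Rightarrow> 'a::real_normed_vector"
  assumes start: "\<And>r. r \<in> {0..1} \<Longrightarrow> norm (w 0 r) \<le> C"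
    and init: "\<And>n. w (Suc n) 0 = 0"
    and deriv: "\<And>n r. r \<in> {0..1} \<Longrightarrow> (w (Suc n) has_vector_derivative d n r) (at r)"
    and bound: "\<And>n r. r \<in> {0..1} \<Longrightarrow> norm (d n r) \<le> M * norm (w n r)"
    and "M \<ge> 0" and "r \<in> {0..1}"
  shows "norm (w n r) \<le> C * (M * r) ^ n / fact n"
  using \<open>r \<in> {0..1}\<close>
proof (induction n arbitrary: r)
  case 0
  then show ?case using start by simp
next
  case (Suc n)
  show ?case
  proof (cases "r = 0")
    case True
    then show ?thesis by (simp add: init)
  next
    case False
    let ?\<phi> = "\<lambda>x. C * (M * x) ^ Suc n / fact (Suc n)"
    have phi: "(?\<phi> has_vector_derivative M * (C * (M * x) ^ n / fact n)) (at x)" for x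
    proof -
      have "(?\<phi> has_real_derivative C * (of_nat (Suc n) * (M * x) ^ n * M) / fact (Suc n)) (at x)"
        by (rule derivative_eq_intros refl | simp)+
      moreover have "C * (of_nat (Suc n) * (M * x) ^ n * M) / fact (Suc n)
          = M * (C * (M * x) ^ n / fact n)"
        by (simp add: divide_simps fact_Suc del: of_nat_Suc)
      ultimately show ?thesis
        by (simp only: has_real_derivative_iff_has_vector_derivative)
    qed
    have "norm (w (Suc n) r - w (Suc n) 0) \<le> ?\<phi> r - ?\<phi> 0"
    proof (rule differentiable_bound_general)
      show "0 < r" using False Suc.prems by auto
      show "continuous_on {0..r} (w (Suc n))"
        using Suc.prems
        by (intro continuous_at_imp_continuous_on ballI has_vector_derivative_continuous[OF deriv])
          auto
      show "continuous_on {0..r} ?\<phi>"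
        using phi by (intro continuous_at_imp_continuous_on ballI has_vector_derivative_continuous)
    next
      fix x assume x: "0 < x" "x < r"
      then have x': "x \<in> {0..1}" using Suc.prems by auto
      show "(w (Suc n) has_vector_derivative d n x) (at x)" using deriv x' .
      show "(?\<phi> has_vector_derivative M * (C * (M * x) ^ n / fact n)) (at x)" by (rule phi)
      show "norm (d n x) \<le> M * (C * (M * x) ^ n / fact n)"
        using bound[OF x', of n] mult_left_mono[OF Suc.IH[OF x'] \<open>M \<ge> 0\<close>] by linarith
    qed
    then show ?thesis by (simp add: init)
  qed
qed

text \<open>A linear equation has a solution on the whole interval, since the Picard series converges there:
  with \<open>u\<^sub>0 = y0\<close> and \<open>u\<^sub>n\<^sub>+\<^sub>1\<close> the primitive of \<open>A u\<^sub>n\<close>, the \<open>n\<close>-th term is at most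
  \<open>|y0| M\<^sup>n / n!\<close> on every compact subinterval, and the series of derivatives is the original
  series with \<open>A\<close> applied to it.\<close>

theorem linear_ode_solution_exists:
  fixes A :: "real \<Rightarrow> 'a::banach \<Rightarrow>\<^sub>L 'a"
  assumes I: "open I" "is_interval I" "c \<in> I" and A: "continuous_on I A"
  obtains y where "y c = y0"
    and "\<And>t. t \<in> I \<Longrightarrow> (y has_vector_derivative A t (y t)) (at t)"
proof -
  define u where "u = rec_nat (\<lambda>t. y0) (\<lambda>n v. primitive_from c (\<lambda>s. A s (v s)))"
  have u0: "u 0 = (\<lambda>t. y0)" by (simp add: u_def)
  have uSuc: "u (Suc n) = primitive_from c (\<lambda>s. A s (u n s))" for n by (simp add: u_def)
  have cont: "continuous_on I (u n)" for n
  proof (induction n)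
    case 0
    then show ?case by (simp add: u_def)
  next
    case (Suc n)
    then have "continuous_on I (\<lambda>s. A s (u n s))"
      using A by (intro continuous_intros)
    from has_vector_derivative_continuous[OF has_vector_derivative_primitive_from[OF I this]]
    show ?case
      unfolding uSuc by (intro continuous_at_imp_continuous_on ballI)
  qed
  have der: "(u (Suc n) has_vector_derivative A t (u n t)) (at t)" if "t \<in> I" for n t
    unfolding uSuc using A cont that
    by (intro has_vector_derivative_primitive_from[OF I] continuous_intros)
  have init: "u (Suc n) c = 0" for n
    by (simp add: uSuc primitive_from_self)
  define y where "y t = (\<Sum>n. u n t)" for t
  have "(y has_vector_derivative A t (y t)) (at t)" if t: "t \<in> I" for t
  proof -
    obtain a b where ab: "a < c" "c < b" "a < t" "t < b" "{a..b} \<subseteq> I"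
      using two_points_inside_compact_interval[OF I t] .
    have "compact ((\<lambda>s. A s) ` {a..b})"
      using A ab(5) by (intro compact_continuous_image) (auto intro: continuous_on_subset)
    then obtain L where L: "L > 0" "\<And>s. s \<in> {a..b} \<Longrightarrow> norm (A s) \<le> L"
      using compact_imp_bounded bounded_pos by (metis imageI)
    define M where "M = (b - a) * L"
    have M: "M \<ge> 0" using L(1) ab by (simp add: M_def)
    have bnd: "norm (u n x) \<le> norm y0 * (M ^ n / fact n)" if x: "x \<in> {a..b}" for n x
    proof -
      let ?g = "\<lambda>r. c + r * (x - c)"
      have g: "?g r \<in> {a..b}" if "r \<in> {0..1}" for r
      proof -
        have "?g r = (1 - r) * c + r * x" by (simp add: algebra_simps)
        also have "\<dots> \<in> {a..b}"
          using convexD[OF convex_real_interval(5)[of a b], of c x "1 - r" r] ab x that by auto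
        finally show ?thesis .
      qed
      have "norm (u n (?g 1)) \<le> norm y0 * (M * 1) ^ n / fact n"
      proof (rule iterated_primitive_bound[where w = "\<lambda>n r. u n (?g r)"
            and d = "\<lambda>n r. (x - c) *\<^sub>R A (?g r) (u n (?g r))"])
        fix n and r :: real assume r: "r \<in> {0..1}"
        have "(?g has_vector_derivative (x - c)) (at r)"
          by (auto intro!: derivative_eq_intros)
        from vector_diff_chain_at[OF this der[of "?g r" n]] g[OF r] ab(5)
        show "((\<lambda>r. u (Suc n) (?g r)) has_vector_derivative
            (x - c) *\<^sub>R A (?g r) (u n (?g r))) (at r)"
          by (auto simp: o_def)
        have "norm (A (?g r) (u n (?g r))) \<le> L * norm (u n (?g r))"
          using norm_blinfun[of "A (?g r)" "u n (?g r)"] mult_right_mono[OF L(2)[OF g[OF r]]]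
          by (meson norm_ge_zero order_trans)
        moreover have "\<bar>x - c\<bar> \<le> b - a" using x ab by auto
        ultimately have "\<bar>x - c\<bar> * norm (A (?g r) (u n (?g r))) \<le> (b - a) * (L * norm (u n (?g r)))"
          by (intro mult_mono) auto
        then show "norm ((x - c) *\<^sub>R A (?g r) (u n (?g r))) \<le> M * norm (u n (?g r))"
          by (simp add: M_def mult_ac)
      qed (use M in \<open>auto simp: u0 init\<close>)
      then show ?thesis by simp
    qed
    have sumM: "summable (\<lambda>n. norm y0 * (M ^ n / fact n))"
      using summable_exp[of M] by (intro summable_mult) (simp add: divide_inverse mult.commute)
    have sumu: "(\<lambda>n. u n x) sums y x" if "x \<in> {a..b}" for x
      unfolding y_def by (rule summable_sums[OF summable_comparison_test'[OF sumM bnd[OF that]]])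
    have unif: "uniform_limit {a..b} (\<lambda>n x. \<Sum>i<n. u i x) y sequentially"
      using Weierstrass_m_test[OF bnd sumM, of "{a..b}"] unfolding y_def by simp
    \<comment> \<open>The derivatives of the terms, shifted by one index: the constant first term contributes nothing.\<close>
    define f' where "f' n x = (\<lambda>h::real. h *\<^sub>R (case n of 0 \<Rightarrow> 0 | Suc m \<Rightarrow> A x (u m x)))" for n x
    have "\<exists>g. \<forall>x\<in>{a..b}. (\<lambda>n. u n x) sums g x \<and>
        (g has_derivative (\<lambda>h. h *\<^sub>R A x (y x))) (at x within {a..b})"
    proof (rule has_derivative_series)
      fix n x assume "x \<in> {a..b}"
      then show "(u n has_derivative f' n x) (at x within {a..b})"
        using der[OF subsetD[OF ab(5)], of x]
        by (cases n) (auto simp: f'_def has_vector_derivative_def u0 intro: has_derivative_at_withinI)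
    next
      fix e :: real assume e: "e > 0"
      then have "e / L > 0" using L by simp
      from uniform_limitD[OF unif this] obtain N where
        N: "\<And>n x. n \<ge> N \<Longrightarrow> x \<in> {a..b} \<Longrightarrow> dist (\<Sum>i<n. u i x) (y x) < e / L"
        unfolding eventually_sequentially by blast
      show "\<forall>\<^sub>F n in sequentially. \<forall>x\<in>{a..b}. \<forall>h.
          norm ((\<Sum>i<n. f' i x h) - h *\<^sub>R A x (y x)) \<le> e * norm h"
      proof (rule eventually_sequentiallyI[of "Suc N"], intro ballI allI)
        fix n x and h :: real assume n: "Suc N \<le> n" and x: "x \<in> {a..b}"
        obtain m where m: "n = Suc m" "m \<ge> N" using n by (cases n) auto
        have "(\<Sum>i<n. f' i x h) = h *\<^sub>R A x (\<Sum>i<m. u i x)"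
          unfolding m sum.lessThan_Suc_shift f'_def
          by (simp add: blinfun.sum_right scaleR_sum_right)
        then have "(\<Sum>i<n. f' i x h) - h *\<^sub>R A x (y x) = h *\<^sub>R A x ((\<Sum>i<m. u i x) - y x)"
          by (simp add: blinfun.diff_right scaleR_diff_right)
        moreover have "norm (A x ((\<Sum>i<m. u i x) - y x)) \<le> e"
        proof -
          have "norm (A x ((\<Sum>i<m. u i x) - y x)) \<le> norm (A x) * norm ((\<Sum>i<m. u i x) - y x)"
            by (rule norm_blinfun)
          also have "\<dots> \<le> L * (e / L)"
            using L(1) L(2)[OF x] N[OF m(2) x] by (intro mult_mono) (auto simp: dist_norm)
          finally show ?thesis using L(1) by simp
        qed
        ultimately show "norm ((\<Sum>i<n. f' i x h) - h *\<^sub>R A x (y x)) \<le> e * norm h"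
          by (simp add: mult.commute[of e] mult_left_mono)
      qed
    qed (use sumu[of c] ab in auto)
    then obtain g where g: "\<And>x. x \<in> {a..b} \<Longrightarrow> (\<lambda>n. u n x) sums g x"
      "\<And>x. x \<in> {a..b} \<Longrightarrow> (g has_derivative (\<lambda>h. h *\<^sub>R A x (y x))) (at x within {a..b})" by blast
    have "g x = y x" if "x \<in> {a..b}" for x
      using g(1) sumu that sums_unique2 by blast
    then have "(y has_derivative (\<lambda>h. h *\<^sub>R A t (y t))) (at t within {a..b})"
      using g(2)[of t] ab by (intro has_derivative_transform[of t "{a..b}" y g]) auto
    then show ?thesis
      using ab at_within_Icc_at[of a t b] by (simp add: has_vector_derivative_def)
  qed
  moreover have "y c = y0"
  proof -
    have "(\<Sum>n. u n c) = (\<Sum>n\<in>{0}. u n c)"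
      by (rule suminf_finite) (auto simp: init gr0_conv_Suc)
    then show ?thesis by (simp add: y_def u0)
  qed
  ultimately show thesis using that by blast
qed

section \<open>Lorentzian algebra\<close>

lemma lorentz_cross_components:
  "lorentz_cross v w $ 1 = v$2 * w$3 - v$3 * w$2"
  "lorentz_cross v w $ 2 = v$3 * w$1 - v$1 * w$3"
  "lorentz_cross v w $ 3 = v$2 * w$1 - v$1 * w$2"
  by (simp_all add: lorentz_cross_def lorentz_Z_def matrix_vector_mult_def sum_3 cross_components)

lemma bounded_bilinear_lorentz_inner: "bounded_bilinear lorentz_inner"
  unfolding bilinear_conv_bounded_bilinear[symmetric] bilinear_def linear_iff
  by (simp add: lorentz_inner_def algebra_simps)

lemma bounded_bilinear_lorentz_cross: "bounded_bilinear lorentz_cross"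
  unfolding bilinear_conv_bounded_bilinear[symmetric] bilinear_def linear_iff
  by (simp add: vec_eq_iff forall_3 lorentz_cross_components algebra_simps)

interpretation lorentz_inner: bounded_bilinear lorentz_inner
  by (rule bounded_bilinear_lorentz_inner)

interpretation lorentz_cross: bounded_bilinear lorentz_cross
  by (rule bounded_bilinear_lorentz_cross)

lemmas lorentz_inner_bilinear_simps =
  lorentz_inner.add_left lorentz_inner.add_right lorentz_inner.diff_left lorentz_inner.diff_right
  lorentz_inner.minus_left lorentz_inner.minus_right
  lorentz_inner.scaleR_left lorentz_inner.scaleR_right
  lorentz_inner.zero_left lorentz_inner.zero_right

lemma lorentz_inner_commute: "\<langle>x, y\<rangle> = \<langle>y, x\<rangle>"
  by (simp add: lorentz_inner_def mult.commute)

lemma lorentz_cross_orthogonal: "\<langle>lorentz_cross v w, v\<rangle> = 0" "\<langle>lorentz_cross v w, w\<rangle> = 0"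
  by (simp_all add: lorentz_inner_def lorentz_cross_components algebra_simps)

lemma lorentz_cross_self: "lorentz_cross v v = 0"
  by (simp add: vec_eq_iff forall_3 lorentz_cross_components)

lemma lorentz_inner_cross_cross:
  "\<langle>lorentz_cross v w, lorentz_cross v w\<rangle> = \<langle>v, w\<rangle>\<^sup>2 - \<langle>v, v\<rangle> * \<langle>w, w\<rangle>"
  by (simp add: lorentz_inner_def lorentz_cross_components power2_eq_square algebra_simps)

text \<open>The Lorentz product is positive definite on the horizontal plane.\<close>

lemma lightlike_third_component_nonzero:
  assumes "\<langle>x, x\<rangle> = 0" "x \<noteq> 0"
  shows "x$3 \<noteq> 0"
proof
  assume "x$3 = 0"
  with assms(1) have "x$1 * x$1 + x$2 * x$2 = 0" by (simp add: lorentz_inner_def)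
  then have "x$1 = 0" "x$2 = 0" by (auto simp: sum_squares_eq_zero_iff)
  with \<open>x$3 = 0\<close> assms(2) show False by (simp add: vec_eq_iff forall_3)
qed

text \<open>If \<open>c = e \<times> k\<close>, then \<open>k k\<^sup>T - c c\<^sup>T = \<langle>k, k\<rangle> (Z - e e\<^sup>T)\<close>: both sides are symmetric, annihilate \<open>Z e\<close>,
  and agree on \<open>Z k\<close> and \<open>Z c\<close>. This settles the case \<open>\<langle>k, k\<rangle> \<noteq> 0\<close>, where these vectors
  form a basis; the null case is a limit. Only the entries in the third row are used below.\<close>

lemma orthogonal_complement_products:
  assumes "\<langle>e, e\<rangle> = 1" "\<langle>e, k\<rangle> = 0"
  defines "c \<equiv> lorentz_cross e k"
  shows "k$3 * k$1 - c$3 * c$1 = - \<langle>k, k\<rangle> * (e$3 * e$1)"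
    and "k$3 * k$2 - c$3 * c$2 = - \<langle>k, k\<rangle> * (e$3 * e$2)"
    and "k$3 * k$3 - c$3 * c$3 = - \<langle>k, k\<rangle> * (1 + e$3 * e$3)"
  using assms(1,2) unfolding c_def lorentz_inner_def lorentz_cross_components
  by algebra+

text \<open>This makes \<open>curvature_sign\<close> well defined. The vectors \<open>k\<close> and \<open>e \<times> k\<close> are null, mutually orthogonal,
  and have third components of the same size. With the sign chosen to match these,
  \<open>e \<times> k - \<epsilon> k\<close> is a null vector with third component zero, hence zero.\<close>

lemma lightlike_normal_cross_eigenvector:
  assumes "\<langle>e, e\<rangle> = 1" "\<langle>e, k\<rangle> = 0" "\<langle>k, k\<rangle> = 0" "k \<noteq> 0"
  shows "\<exists>!\<epsilon>. \<epsilon> \<in> {1, - 1} \<and> lorentz_cross e k = \<epsilon> *\<^sub>R k"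
proof -
  let ?c = "lorentz_cross e k"
  have "k$3 * k$3 = ?c$3 * ?c$3"
    using orthogonal_complement_products(3)[OF assms(1,2)] assms(3) by simp
  then have "?c$3 = k$3 \<or> ?c$3 = - k$3"
    using square_eq_iff by fastforce
  then obtain \<epsilon> where eps: "\<epsilon> \<in> {1, - 1}" "(?c - \<epsilon> *\<^sub>R k)$3 = 0"
    by fastforce
  have "\<langle>?c - \<epsilon> *\<^sub>R k, ?c - \<epsilon> *\<^sub>R k\<rangle> = 0"
    using assms by (simp add: lorentz_inner_bilinear_simps lorentz_inner_cross_cross
        lorentz_cross_orthogonal lorentz_inner_commute[of k ?c])
  with eps(2) have "?c = \<epsilon> *\<^sub>R k"
    using lightlike_third_component_nonzero by fastforce
  with eps(1) show ?thesis
    using assms(4) by (metis scaleR_cancel_right)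
qed

section \<open>Frames with a null third vector\<close>

text \<open>The Gram matrix of the curve frame \<open>e, \<kappa>, \<beta>\<close>, with \<open>t\<close> in the place of \<open>\<theta>\<close>. Its determinant is \<open>- 1\<close>
  even where \<open>t = 0\<close>, which is the reason for replacing \<open>e \<times> \<kappa>\<close> by \<open>\<beta>\<close>.\<close>

definition adapted_frame :: "real \<Rightarrow> real^3 \<Rightarrow> real^3 \<Rightarrow> real^3 \<Rightarrow> bool"
  where "adapted_frame t e k b \<longleftrightarrow>
    \<langle>e, e\<rangle> = 1 \<and> \<langle>e, k\<rangle> = 0 \<and> \<langle>e, b\<rangle> = 0 \<and> \<langle>k, k\<rangle> = t \<and> \<langle>k, b\<rangle> = 1 \<and> \<langle>b, b\<rangle> = 0"

text \<open>If \<open>G\<close> is the Gram matrix of an adapted frame, and \<open>F\<close>, \<open>F'\<close> are the matrices with columns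
  \<open>e, k, b\<close> and \<open>e', k', b'\<close>, this is the linear map \<open>F' G\<inverse> F\<^sup>T Z\<close>. When \<open>e, k, b\<close> is adapted,
  \<open>G\<inverse> F\<^sup>T Z = F\<inverse>\<close>, so that the map carries the first frame to the second.\<close>

definition frame_transfer ::
    "real \<Rightarrow> real^3 \<Rightarrow> real^3 \<Rightarrow> real^3 \<Rightarrow> real^3 \<Rightarrow> real^3 \<Rightarrow> real^3 \<Rightarrow> real^3 \<Rightarrow> real^3"
  where "frame_transfer t e k b e' k' b' x =
    \<langle>x, e\<rangle> *\<^sub>R e' + \<langle>x, b\<rangle> *\<^sub>R k' + (\<langle>x, k\<rangle> - t * \<langle>x, b\<rangle>) *\<^sub>R b'"

text \<open>In matrix terms, \<open>F\<^sup>T Z F = G\<close> holds if and only if \<open>F G\<inverse> F\<^sup>T Z = 1\<close>, because a one-sided inverse of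
  a square matrix is two-sided. The forward direction is the expansion of a vector in an adapted
  frame; the backward direction recovers all six products from that expansion.\<close>

lemma adapted_frame_iff_frame_transfer_id:
  "adapted_frame t e k b \<longleftrightarrow> (\<forall>x. frame_transfer t e k b e k b x = x)"
proof -
  define L where "L v = (v$1) *\<^sub>R e + (v$2) *\<^sub>R k + (v$3) *\<^sub>R b" for v :: "real^3"
  have lin: "linear L"
    by (auto simp: L_def linear_iff scaleR_add_left scaleR_add_right)
  have L3: "L (vector [p, q, r]) = p *\<^sub>R e + q *\<^sub>R k + r *\<^sub>R b" for p q r
    by (simp add: L_def)
  show ?thesis
  proof
    assume fr: "adapted_frame t e k b"
    have inner_L: "\<langle>L v, e\<rangle> = v$1" "\<langle>L v, b\<rangle> = v$2" "\<langle>L v, k\<rangle> = t * v$2 + v$3" for v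
      using fr by (auto simp: L_def adapted_frame_def lorentz_inner_bilinear_simps
          lorentz_inner_commute[of k e] lorentz_inner_commute[of b e] lorentz_inner_commute[of b k])
    have "inj L"
      unfolding linear_injective_0[OF lin]
    proof (intro allI impI)
      fix v assume "L v = 0"
      with inner_L[of v] show "v = 0"
        by (auto simp: vec_eq_iff forall_3 lorentz_inner_bilinear_simps)
    qed
    then have "surj L" using lin linear_injective_imp_surjective by blast
    show "\<forall>x. frame_transfer t e k b e k b x = x"
    proof
      fix x
      obtain v where "x = L v" using \<open>surj L\<close> by blast
      then show "frame_transfer t e k b e k b x = x"
        by (simp add: frame_transfer_def inner_L) (simp add: L_def)
    qed
  next
    assume id: "\<forall>x. frame_transfer t e k b e k b x = x"
    then have "x = L (vector [\<langle>x, e\<rangle>, \<langle>x, b\<rangle>, \<langle>x, k\<rangle> - t * \<langle>x, b\<rangle>])" for x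
      by (simp add: L3 frame_transfer_def)
    then have "surj L" unfolding surj_def by blast
    then have "inj L" using lin linear_surjective_imp_injective by blast
    have coords: "\<langle>x, e\<rangle> = p \<and> \<langle>x, b\<rangle> = q \<and> \<langle>x, k\<rangle> - t * \<langle>x, b\<rangle> = r"
      if "x = p *\<^sub>R e + q *\<^sub>R k + r *\<^sub>R b" for x p q r
    proof -
      have "L (vector [\<langle>x, e\<rangle>, \<langle>x, b\<rangle>, \<langle>x, k\<rangle> - t * \<langle>x, b\<rangle>]) = L (vector [p, q, r])"
        using id that by (simp add: L3 frame_transfer_def)
      then have "vector [\<langle>x, e\<rangle>, \<langle>x, b\<rangle>, \<langle>x, k\<rangle> - t * \<langle>x, b\<rangle>] = (vector [p, q, r] :: real^3)"
        using \<open>inj L\<close> by (rule injD[rotated])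
      then show ?thesis
        by (auto simp: vec_eq_iff forall_3)
    qed
    from coords[of e 1 0 0] coords[of k 0 1 0] coords[of b 0 0 1]
    show "adapted_frame t e k b"
      by (simp add: adapted_frame_def lorentz_inner_commute)
  qed
qed

lemma frame_transfer_linear: "linear (frame_transfer t e k b e' k' b')"
  by (auto simp: linear_iff frame_transfer_def lorentz_inner_bilinear_simps algebra_simps)

lemma frame_transfer_maps_frame:
  assumes "adapted_frame t e k b"
  shows "frame_transfer t e k b e' k' b' e = e'"
  using assms by (simp add: adapted_frame_def frame_transfer_def)

lemma frame_transfer_isometric:
  assumes "adapted_frame t e k b" "adapted_frame t e' k' b'"
  shows "\<langle>frame_transfer t e k b e' k' b' x, frame_transfer t e k b e' k' b' y\<rangle> = \<langle>x, y\<rangle>"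
proof -
  have gram: "\<langle>frame_transfer t e k b f l d x, frame_transfer t e k b f l d y\<rangle> =
      \<langle>x, e\<rangle> * \<langle>y, e\<rangle> + \<langle>x, b\<rangle> * \<langle>y, b\<rangle> * t + \<langle>x, b\<rangle> * (\<langle>y, k\<rangle> - t * \<langle>y, b\<rangle>)
        + (\<langle>x, k\<rangle> - t * \<langle>x, b\<rangle>) * \<langle>y, b\<rangle>"
    if "adapted_frame t f l d" for f l d
    using that lorentz_inner_commute[of l f] lorentz_inner_commute[of d f]
      lorentz_inner_commute[of d l]
    by (simp add: adapted_frame_def frame_transfer_def lorentz_inner_bilinear_simps algebra_simps)
  have "frame_transfer t e k b e k b z = z" for z
    using assms(1) adapted_frame_iff_frame_transfer_id by blast
  then show ?thesis
    using gram[OF assms(1)] gram[OF assms(2)] by simp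
qed

text \<open>Let \<open>e\<close> be a unit vector, \<open>k\<close> orthogonal to \<open>e\<close>, and \<open>p = k + \<epsilon> e \<times> k\<close>, a null vector. The Lorentzian
  plane orthogonal to \<open>e\<close> contains exactly two null lines. Reflecting \<open>p\<close> along the timelike projection
  \<open>r = E\<^sub>3 + e\<^sub>3 e\<close> of the third basis vector to that plane gives a vector on the other line, and
  \<open>null_companion\<close> is its multiple whose product with \<open>p\<close> is \<open>2\<close>.\<close>

definition null_companion :: "real \<Rightarrow> real^3 \<Rightarrow> real^3 \<Rightarrow> real^3"
  where "null_companion \<epsilon> e k = (let p = k + \<epsilon> *\<^sub>R lorentz_cross e k in
    inverse (p$3 * p$3) *\<^sub>R
      ((1 + e$3 * e$3) *\<^sub>R p + (- 2 * p$3) *\<^sub>R (axis 3 1 + (e$3) *\<^sub>R e)))"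

text \<open>The null vector \<open>q = k - \<epsilon> e \<times> k\<close> has product \<open>2 \<langle>k, k\<rangle>\<close> with \<open>p\<close> and lies on the line opposite to \<open>p\<close>,
  so it is \<open>\<langle>k, k\<rangle>\<close> times the companion \<open>b\<close>. This is the division of \<open>\<kappa> - \<epsilon> e \<times> \<kappa>\<close> by \<open>\<theta>\<close> in closed
  form. It only requires \<open>p \<noteq> 0\<close> and thus succeeds at a zero of \<open>\<theta>\<close> of any order, even infinite.\<close>

lemma null_companion:
  assumes unit: "\<langle>e, e\<rangle> = 1" "\<langle>e, k\<rangle> = 0" and eps: "\<epsilon> \<in> {1, - 1}"
    and nz: "k + \<epsilon> *\<^sub>R lorentz_cross e k \<noteq> 0"
  defines "b \<equiv> null_companion \<epsilon> e k"
  shows null_companion_third: "(k + \<epsilon> *\<^sub>R lorentz_cross e k) $ 3 \<noteq> 0"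
    and null_companion_adapted: "adapted_frame \<langle>k, k\<rangle> e k b"
    and null_companion_cross: "lorentz_cross e k = \<epsilon> *\<^sub>R (k - \<langle>k, k\<rangle> *\<^sub>R b)"
proof -
  define c where "c = lorentz_cross e k"
  define p where "p = k + \<epsilon> *\<^sub>R c"
  define q where "q = k - \<epsilon> *\<^sub>R c"
  define t where "t = \<langle>k, k\<rangle>"
  define r where "r = axis 3 1 + (e$3) *\<^sub>R e"
  have ee: "\<epsilon> * \<epsilon> = 1" using eps by auto
  have c: "\<langle>c, e\<rangle> = 0" "\<langle>e, c\<rangle> = 0" "\<langle>c, k\<rangle> = 0" "\<langle>k, c\<rangle> = 0" "\<langle>c, c\<rangle> = - t"
    using lorentz_cross_orthogonal[of e k] lorentz_inner_cross_cross[of e k] unit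
    by (simp_all add: c_def t_def lorentz_inner_commute)
  have pp: "\<langle>p, p\<rangle> = 0"
    using c ee by (simp add: p_def lorentz_inner_bilinear_simps t_def[symmetric])
  show p3': "(k + \<epsilon> *\<^sub>R lorentz_cross e k) $ 3 \<noteq> 0"
    using lightlike_third_component_nonzero[OF pp] nz by (simp add: p_def c_def)
  then have p3: "p$3 \<noteq> 0" by (simp add: p_def c_def)
  have b: "b = inverse (p$3 * p$3) *\<^sub>R ((1 + e$3 * e$3) *\<^sub>R p + (- 2 * p$3) *\<^sub>R r)"
    unfolding b_def null_companion_def Let_def p_def c_def r_def by (rule refl)
  have axis: "\<langle>axis 3 1, x\<rangle> = - x$3" "\<langle>x, axis 3 1\<rangle> = - x$3" for x
    by (simp_all add: lorentz_inner_def axis_def)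
  have axis3: "(axis 3 1 :: real^3) $ 3 = 1" by (simp add: axis_def)
  have ep: "\<langle>e, p\<rangle> = 0" and er: "\<langle>e, r\<rangle> = 0" and pr: "\<langle>p, r\<rangle> = - p$3" "\<langle>r, p\<rangle> = - p$3"
    and rr: "\<langle>r, r\<rangle> = - (1 + e$3 * e$3)"
    using unit c lorentz_inner_commute[of p e]
    by (simp_all add: p_def r_def lorentz_inner_bilinear_simps axis lorentz_inner_commute[of k e] axis3)
  have prod: "p$3 * q$i + q$3 * p$i = 2 * (k$3 * k$i - c$3 * c$i)" for i
  proof -
    have "p$3 * q$i + q$3 * p$i = 2 * (k$3 * k$i - (\<epsilon> * \<epsilon>) * (c$3 * c$i))"
      by (simp add: p_def q_def algebra_simps)
    then show ?thesis by (simp add: ee)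
  qed
  note comp = orthogonal_complement_products[OF unit, folded c_def t_def]
  have e3: "p$3 * q$3 = - t * (1 + e$3 * e$3)"
    using prod[of 3] comp(3) by simp
  have e1: "p$3 * q$1 + q$3 * p$1 = - 2 * t * (e$3 * e$1)"
    using prod[of 1] comp(1) by simp
  have e2: "p$3 * q$2 + q$3 * p$2 = - 2 * t * (e$3 * e$2)"
    using prod[of 2] comp(2) by simp
  \<comment> \<open>The claim \<open>q = t b\<close>, multiplied by \<open>p\<^sub>3\<^sup>2\<close> to make it polynomial.\<close>
  have "(p$3 * p$3) * q$i = t * ((1 + e$3 * e$3) * p$i + (- 2 * p$3) * r$i)" for i
    using exhaust_3[of i]
  proof (elim disjE)
    assume i: "i = 1"
    have "r$1 = e$3 * e$1" by (simp add: r_def axis_def)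
    with e1 e3 show ?thesis unfolding i by algebra
  next
    assume i: "i = 2"
    have "r$2 = e$3 * e$2" by (simp add: r_def axis_def)
    with e2 e3 show ?thesis unfolding i by algebra
  next
    assume i: "i = 3"
    have "r$3 = 1 + e$3 * e$3" by (simp add: r_def axis_def)
    with e3 show ?thesis unfolding i by algebra
  qed
  note cleared = this
  have "q$i = t * b$i" for i
  proof -
    have "q$i = inverse (p$3 * p$3) * ((p$3 * p$3) * q$i)"
      using p3 by (simp add: field_simps)
    also have "\<dots> = t * b$i" unfolding cleared b by (simp add: algebra_simps)
    finally show ?thesis .
  qed
  then have tb: "t *\<^sub>R b = q"
    by (simp add: vec_eq_iff)
  show "lorentz_cross e k = \<epsilon> *\<^sub>R (k - \<langle>k, k\<rangle> *\<^sub>R b)"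
    using ee by (simp add: t_def[symmetric] tb q_def c_def scaleR_scaleR)
  have eb: "\<langle>e, b\<rangle> = 0"
    by (simp add: b lorentz_inner_bilinear_simps ep er)
  have bb: "\<langle>b, b\<rangle> = 0"
    by (simp add: b lorentz_inner_bilinear_simps pp pr rr algebra_simps)
  have pb: "\<langle>p, b\<rangle> = 2"
    using p3 by (simp add: b lorentz_inner_bilinear_simps pp pr) (simp add: field_simps)
  have "2 *\<^sub>R k = p + t *\<^sub>R b"
    unfolding tb by (simp add: p_def q_def scaleR_2)
  then have "\<langle>2 *\<^sub>R k, b\<rangle> = \<langle>p + t *\<^sub>R b, b\<rangle>" by simp
  then have kb: "\<langle>k, b\<rangle> = 1"
    by (simp add: lorentz_inner_bilinear_simps pb bb)
  show "adapted_frame \<langle>k, k\<rangle> e k b"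
    using unit eb bb kb by (simp add: adapted_frame_def)
qed

section \<open>The frame equations\<close>

text \<open>Differentiating the six products of the frame \<open>e = \<gamma>', \<kappa> = \<gamma>'', \<beta>\<close> and using \<open>\<mu> = - \<langle>\<kappa>', \<beta>\<rangle>\<close> determines
  the coefficients of \<open>\<kappa>'\<close> and \<open>\<beta>'\<close>: this is the analogue of the Frenet system.\<close>

definition frame_equations ::
    "real set \<Rightarrow> (real \<Rightarrow> real) \<Rightarrow> (real \<Rightarrow> real) \<Rightarrow>
      (real \<Rightarrow> real^3) \<Rightarrow> (real \<Rightarrow> real^3) \<Rightarrow> (real \<Rightarrow> real^3) \<Rightarrow> bool"
  where "frame_equations I \<theta> \<mu> e k b \<longleftrightarrow> (\<forall>s\<in>I.
    (e has_vector_derivative k s) (at s) \<and>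
    (k has_vector_derivative
      (- \<theta> s) *\<^sub>R e s - \<mu> s *\<^sub>R k s + (vderiv \<theta> s / 2 + \<mu> s * \<theta> s) *\<^sub>R b s) (at s) \<and>
    (b has_vector_derivative - e s + \<mu> s *\<^sub>R b s) (at s))"

lemma has_vector_derivative_lorentz_inner:
  assumes "(f has_vector_derivative f') (at s)" "(g has_vector_derivative g') (at s)"
  shows "((\<lambda>s. \<langle>f s, g s\<rangle>) has_vector_derivative \<langle>f s, g'\<rangle> + \<langle>f', g s\<rangle>) (at s)"
  using lorentz_inner.has_vector_derivative[OF assms] .

lemma constant_if_derivative_zero:
  fixes f :: "real \<Rightarrow> 'a::real_normed_vector"
  assumes "is_interval I" "\<And>s. s \<in> I \<Longrightarrow> (f has_vector_derivative 0) (at s)" "s \<in> I" "t \<in> I"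
  shows "f s = f t"
proof -
  have "(f has_derivative (\<lambda>h. 0)) (at s within I)" if "s \<in> I" for s
    using assms(2)[OF that] by (simp add: has_vector_derivative_def has_derivative_at_withinI)
  from has_derivative_zero_constant[OF is_interval_convex[OF assms(1)] this]
  show ?thesis using assms(3,4) by metis
qed

lemma derivatives_agree_on_open:
  assumes "open S" "\<And>x. x \<in> S \<Longrightarrow> f x = g x" "s \<in> S"
    and "(f has_vector_derivative f') (at s)" "(g has_vector_derivative g') (at s)"
  shows "f' = g'"
  using has_vector_derivative_transform_within_open[OF assms(4,1,3,2)] assms(5)
    vector_derivative_unique_at by blast

text \<open>With \<open>K\<close> the coefficient matrix, \<open>F' = F K\<close> for each frame, and the prescribed Gram matrix satisfies
  \<open>G' = K\<^sup>T G + G K\<close>; hence \<open>F\<^sub>2 G\<inverse> F\<^sub>1\<^sup>T Z\<close> has derivative zero, whatever the initial values of the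
  two solutions. For two curves this shows that one linear map relates their frames at all
  times; for a single solution it shows that an initially adapted frame remains adapted. It takes
  the place of the uniqueness theorem for linear differential equations in both.\<close>

lemma frame_transfer_constant:
  assumes I: "is_interval I" and \<theta>: "smooth_on I \<theta>"
    and eq: "frame_equations I \<theta> \<mu> e k b" "frame_equations I \<theta> \<mu> e' k' b'"
    and "s \<in> I" "t \<in> I"
  shows "frame_transfer (\<theta> s) (e s) (k s) (b s) (e' s) (k' s) (b' s) x =
    frame_transfer (\<theta> t) (e t) (k t) (b t) (e' t) (k' t) (b' t) x"
proof (rule constant_if_derivative_zero[OF I _ \<open>s \<in> I\<close> \<open>t \<in> I\<close>])
  fix s assume "s \<in> I"
  define \<nu> where "\<nu> = vderiv \<theta> s / 2 + \<mu> s * \<theta> s"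
  note inner_right = bounded_linear.has_vector_derivative[OF lorentz_inner.bounded_linear_right]
  note scale = bounded_bilinear.has_vector_derivative[OF bounded_bilinear_scaleR]
  note mult = bounded_bilinear.has_vector_derivative[OF bounded_bilinear_mult]
  have d: "(e has_vector_derivative k s) (at s)"
      "(k has_vector_derivative (- \<theta> s) *\<^sub>R e s - \<mu> s *\<^sub>R k s + \<nu> *\<^sub>R b s) (at s)"
      "(b has_vector_derivative - e s + \<mu> s *\<^sub>R b s) (at s)"
    and d': "(e' has_vector_derivative k' s) (at s)"
      "(k' has_vector_derivative (- \<theta> s) *\<^sub>R e' s - \<mu> s *\<^sub>R k' s + \<nu> *\<^sub>R b' s) (at s)"
      "(b' has_vector_derivative - e' s + \<mu> s *\<^sub>R b' s) (at s)"
    using eq \<open>s \<in> I\<close> unfolding frame_equations_def \<nu>_def by blast+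
  have th: "(\<theta> has_vector_derivative vderiv \<theta> s) (at s)"
    using smooth_on_has_vector_derivative[OF \<theta> \<open>s \<in> I\<close>] .
  have two: "vderiv \<theta> s = 2 * \<nu> - 2 * \<mu> s * \<theta> s" by (simp add: \<nu>_def field_simps)
  show "((\<lambda>s. frame_transfer (\<theta> s) (e s) (k s) (b s) (e' s) (k' s) (b' s) x)
      has_vector_derivative 0) (at s)"
    unfolding frame_transfer_def
    by (rule has_vector_derivative_eq_rhs,
        (rule has_vector_derivative_add has_vector_derivative_diff scale mult inner_right d d' th)+,
        simp add: two lorentz_inner_bilinear_simps vec_eq_iff, simp add: algebra_simps)
qed

section \<open>The frame of a curve with a lightlike curvature vector\<close>

text \<open>The defining equation determines the field by division wherever the causal curvature does not
  vanish, and continuity determines it at the one remaining point.\<close>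

lemma is_pseudo_binormal_unique:
  assumes "open J" "s\<^sub>0 \<in> J"
    and sgn: "curvature_sign \<gamma> s\<^sub>0 \<noteq> 0"
    and zero: "\<And>s. s \<in> J \<Longrightarrow> causal_curvature \<gamma> s = 0 \<longleftrightarrow> s = s\<^sub>0"
    and b: "is_pseudo_binormal J s\<^sub>0 \<gamma> b" "is_pseudo_binormal J s\<^sub>0 \<gamma> b'"
    and "s \<in> J"
  shows "b s = b' s"
proof -
  have off: "b s = b' s" if "s \<in> J" "s \<noteq> s\<^sub>0" for s
  proof -
    have "curvature_sign \<gamma> s\<^sub>0 *\<^sub>R (curvature_vector \<gamma> s - causal_curvature \<gamma> s *\<^sub>R b s) =
      curvature_sign \<gamma> s\<^sub>0 *\<^sub>R (curvature_vector \<gamma> s - causal_curvature \<gamma> s *\<^sub>R b' s)"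
      using b that(1) unfolding is_pseudo_binormal_def by metis
    with sgn zero that show ?thesis by simp
  qed
  have "b s\<^sub>0 = b' s\<^sub>0"
  proof (rule tendsto_unique[of "at s\<^sub>0"])
    have lim: "(f \<longlongrightarrow> f s\<^sub>0) (at s\<^sub>0)" if "is_pseudo_binormal J s\<^sub>0 \<gamma> f" for f
      using that assms(1,2) smooth_on_continuous_on continuous_on_eq_continuous_at
      unfolding is_pseudo_binormal_def isCont_def by blast
    show "(b \<longlongrightarrow> b s\<^sub>0) (at s\<^sub>0)" using lim[OF b(1)] .
    have "\<forall>\<^sub>F s in at s\<^sub>0. s \<in> J \<and> s \<noteq> s\<^sub>0"
      using eventually_at_in_open[OF assms(1,2)] by simp
    then have "\<forall>\<^sub>F s in at s\<^sub>0. b' s = b s"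
      by eventually_elim (simp add: off)
    from tendsto_cong[OF this] lim[OF b(2)]
    show "(b \<longlongrightarrow> b' s\<^sub>0) (at s\<^sub>0)" by simp
  qed simp
  with off \<open>s \<in> J\<close> show ?thesis by blast
qed

lemma pseudo_binormal_eq:
  assumes "open J" "s\<^sub>0 \<in> J"
    and "curvature_sign \<gamma> s\<^sub>0 \<noteq> 0"
    and "\<And>s. s \<in> J \<Longrightarrow> causal_curvature \<gamma> s = 0 \<longleftrightarrow> s = s\<^sub>0"
    and "is_pseudo_binormal J s\<^sub>0 \<gamma> b" "s \<in> J"
  shows "pseudo_binormal J s\<^sub>0 \<gamma> s = b s"
  using is_pseudo_binormal_unique[OF assms(1-4) _ assms(5,6)]
    someI[of "is_pseudo_binormal J s\<^sub>0 \<gamma>", OF assms(5)]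
  unfolding pseudo_binormal_def by blast

lemma smooth_on_lorentz_cross:
  "open S \<Longrightarrow> smooth_on S f \<Longrightarrow> smooth_on S g \<Longrightarrow> smooth_on S (\<lambda>s. lorentz_cross (f s) (g s))"
  by (rule smooth_on_bilinear[OF _ bounded_bilinear_lorentz_cross])

lemma smooth_on_null_companion:
  assumes "open S" "smooth_on S e" "smooth_on S k"
    and "\<And>s. s \<in> S \<Longrightarrow> (k s + \<epsilon> *\<^sub>R lorentz_cross (e s) (k s)) $ 3 \<noteq> 0"
  shows "smooth_on S (\<lambda>s. null_companion \<epsilon> (e s) (k s))"
proof -
  define p where "p s = k s + \<epsilon> *\<^sub>R lorentz_cross (e s) (k s)" for s
  have p: "smooth_on S p"
    unfolding p_def using assms(1-3)
    by (intro smooth_on_add smooth_on_scaleR smooth_on_lorentz_cross smooth_on_const)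
  have "p s $ 3 * p s $ 3 \<noteq> 0" if "s \<in> S" for s
    using assms(4)[OF that] by (simp add: p_def)
  then show ?thesis
    unfolding null_companion_def Let_def p_def[symmetric]
    using assms(1,2) p
    by (intro smooth_on_scaleR smooth_on_inverse smooth_on_add smooth_on_mult smooth_on_vec_nth
        smooth_on_const)
qed

text \<open>Every curve with the prescribed invariants has a pseudo-binormal, given by \<open>null_companion\<close> for its
  sign \<open>\<epsilon>\<close>. The vector \<open>p = \<kappa> + \<epsilon> e \<times> \<kappa>\<close> vanishes nowhere: at \<open>s\<^sub>0\<close> it is \<open>2 \<kappa>\<close>, and elsewhere
  \<open>\<langle>\<kappa>, p\<rangle> = \<theta> \<noteq> 0\<close>. Since the companion is a smooth expression in \<open>e\<close> and \<open>\<kappa>\<close>, the field is smooth, and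
  it must coincide with the choice made in the definition of the pseudo-torsion.\<close>

lemma curve_frame:
  assumes I: "open I" "s\<^sub>0 \<in> I"
    and zero: "\<And>s. s \<in> I \<Longrightarrow> \<theta> s = 0 \<longleftrightarrow> s = s\<^sub>0" and \<theta>: "smooth_on I \<theta>"
    and curve: "curve_with_invariants I s\<^sub>0 \<theta> \<mu> \<gamma>"
  obtains b where "frame_equations I \<theta> \<mu> (vderiv \<gamma>) (curvature_vector \<gamma>) b"
    and "\<And>s. s \<in> I \<Longrightarrow> adapted_frame (\<theta> s) (vderiv \<gamma> s) (curvature_vector \<gamma> s) (b s)"
proof -
  define e where "e = vderiv \<gamma>"
  define k where "k = curvature_vector \<gamma>"
  define \<epsilon> where "\<epsilon> = curvature_sign \<gamma> s\<^sub>0"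
  define b where "b s = null_companion \<epsilon> (e s) (k s)" for s
  have ee: "\<langle>e s, e s\<rangle> = 1" and k0: "k s \<noteq> 0" and kk: "\<langle>k s, k s\<rangle> = \<theta> s"
    and tors: "pseudo_torsion I s\<^sub>0 \<gamma> s = \<mu> s" if "s \<in> I" for s
    using curve that
    by (auto simp: curve_with_invariants_def unit_speed_def causal_curvature_def e_def k_def)
  have k: "k = vderiv e" by (simp add: k_def e_def curvature_vector_def)
  have e: "vector_derivative \<gamma> (at s) = e s" for s by (simp add: e_def)
  have smooth: "smooth_on I e" "smooth_on I k"
    using curve by (auto simp: curve_with_invariants_def spacelike_curve_def e_def k
        intro: smooth_on_vderiv)
  have de: "(e has_vector_derivative k s) (at s)"
    and dk: "(k has_vector_derivative vderiv k s) (at s)" if "s \<in> I" for s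
    using smooth_on_has_vector_derivative smooth that k by auto
  have inner_deriv: "\<langle>f s, g'\<rangle> + \<langle>f', g s\<rangle> = h'"
    if "\<And>t. t \<in> I \<Longrightarrow> \<langle>f t, g t\<rangle> = h t" "s \<in> I" "(f has_vector_derivative f') (at s)"
      "(g has_vector_derivative g') (at s)" "(h has_vector_derivative h') (at s)" for f g h s f' g' h'
    using derivatives_agree_on_open[OF I(1) that(1,2)
        has_vector_derivative_lorentz_inner[OF that(3,4)] that(5)] .
  have ek: "\<langle>e s, k s\<rangle> = 0" if "s \<in> I" for s
    using inner_deriv[OF ee that de[OF that] de[OF that] has_vector_derivative_const]
      lorentz_inner_commute[of "k s" "e s"] by simp
  have "\<epsilon> \<in> {1, - 1} \<and> lorentz_cross (e s\<^sub>0) (k s\<^sub>0) = \<epsilon> *\<^sub>R k s\<^sub>0"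
    unfolding \<epsilon>_def curvature_sign_def e k_def[symmetric]
    by (rule theI'[OF lightlike_normal_cross_eigenvector])
      (use ee ek k0 kk zero I(2) in auto)
  then have eps: "\<epsilon> \<in> {1, - 1}" and eps0: "lorentz_cross (e s\<^sub>0) (k s\<^sub>0) = \<epsilon> *\<^sub>R k s\<^sub>0"
    by auto
  have nz: "k s + \<epsilon> *\<^sub>R lorentz_cross (e s) (k s) \<noteq> 0" if "s \<in> I" for s
  proof
    let ?c = "lorentz_cross (e s) (k s)"
    assume p: "k s + \<epsilon> *\<^sub>R ?c = 0"
    show False
    proof (cases "s = s\<^sub>0")
      case True
      with p eps0 eps have "k s + k s = 0" by auto
      then show False using k0[OF that] by (simp flip: scaleR_2)
    next
      case False
      have "\<langle>k s, k s + \<epsilon> *\<^sub>R ?c\<rangle> = \<theta> s"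
        using kk[OF that] lorentz_cross_orthogonal(2)[of "e s" "k s"]
        by (simp add: lorentz_inner_bilinear_simps lorentz_inner_commute[of "k s" ?c])
      with p False zero that show False by (simp add: lorentz_inner_bilinear_simps)
    qed
  qed
  have frame: "adapted_frame (\<theta> s) (e s) (k s) (b s)" if "s \<in> I" for s
    using null_companion_adapted[OF ee[OF that] ek[OF that] eps nz[OF that]] kk[OF that]
    by (simp add: b_def)
  have b_smooth: "smooth_on I b"
    unfolding b_def
    by (rule smooth_on_null_companion[OF I(1) smooth null_companion_third[OF ee ek eps nz]])
  have "is_pseudo_binormal I s\<^sub>0 \<gamma> b"
    unfolding is_pseudo_binormal_def causal_curvature_def \<epsilon>_def[symmetric] e k_def[symmetric]
    using b_smooth null_companion_cross[OF ee ek eps nz] by (simp add: b_def)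
  moreover have "causal_curvature \<gamma> s = 0 \<longleftrightarrow> s = s\<^sub>0" if "s \<in> I" for s
    using kk zero that by (simp add: causal_curvature_def k_def)
  ultimately have pb: "pseudo_binormal I s\<^sub>0 \<gamma> s = b s" if "s \<in> I" for s
    using pseudo_binormal_eq[OF I] eps that by (auto simp: \<epsilon>_def)
  have db: "(b has_vector_derivative vderiv b s) (at s)" if "s \<in> I" for s
    using smooth_on_has_vector_derivative[OF b_smooth that] .
  have "frame_equations I \<theta> \<mu> e k b"
    unfolding frame_equations_def
  proof (intro ballI conjI)
    fix s assume s: "s \<in> I"
    have gram: "\<langle>e t, b t\<rangle> = 0" "\<langle>k t, b t\<rangle> = 1" "\<langle>b t, b t\<rangle> = 0" if "t \<in> I" for t
      using frame[OF that] by (auto simp: adapted_frame_def)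
    have expand: "x = \<langle>x, e s\<rangle> *\<^sub>R e s + \<langle>x, b s\<rangle> *\<^sub>R k s + (\<langle>x, k s\<rangle> - \<theta> s * \<langle>x, b s\<rangle>) *\<^sub>R b s" for x
      using frame[OF s] adapted_frame_iff_frame_transfer_id by (metis frame_transfer_def)
    have kb': "\<langle>vderiv k s, b s\<rangle> = - \<mu> s"
      using tors[OF s] pb[OF s] by (simp add: pseudo_torsion_def k_def)
    note zero_deriv = has_vector_derivative_const[where c = "0::real"]
      has_vector_derivative_const[where c = "1::real"]
    have "\<langle>e s, vderiv k s\<rangle> + \<langle>k s, k s\<rangle> = 0"
      by (rule inner_deriv[OF ek s de[OF s] dk[OF s] zero_deriv(1)])
    then have ke': "\<langle>vderiv k s, e s\<rangle> = - \<theta> s"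
      using kk[OF s] by (simp add: lorentz_inner_commute)
    have "\<langle>k s, vderiv k s\<rangle> + \<langle>vderiv k s, k s\<rangle> = vderiv \<theta> s"
      by (rule inner_deriv[OF kk s dk[OF s] dk[OF s] smooth_on_has_vector_derivative[OF \<theta> s]])
    then have kk': "\<langle>vderiv k s, k s\<rangle> = vderiv \<theta> s / 2"
      by (simp add: lorentz_inner_commute)
    have "\<langle>e s, vderiv b s\<rangle> + \<langle>k s, b s\<rangle> = 0"
      by (rule inner_deriv[OF gram(1) s de[OF s] db[OF s] zero_deriv(1)])
    then have be': "\<langle>vderiv b s, e s\<rangle> = - 1"
      using gram(2)[OF s] by (simp add: lorentz_inner_commute)
    have "\<langle>b s, vderiv b s\<rangle> + \<langle>vderiv b s, b s\<rangle> = 0"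
      by (rule inner_deriv[OF gram(3) s db[OF s] db[OF s] zero_deriv(1)])
    then have bb': "\<langle>vderiv b s, b s\<rangle> = 0"
      by (simp add: lorentz_inner_commute)
    have "\<langle>k s, vderiv b s\<rangle> + \<langle>vderiv k s, b s\<rangle> = 0"
      by (rule inner_deriv[OF gram(2) s dk[OF s] db[OF s] zero_deriv(2)])
    then have bk': "\<langle>vderiv b s, k s\<rangle> = \<mu> s"
      using kb' by (simp add: lorentz_inner_commute)
    show "(e has_vector_derivative k s) (at s)" by (rule de[OF s])
    have "vderiv k s =
        (- \<theta> s) *\<^sub>R e s - \<mu> s *\<^sub>R k s + (vderiv \<theta> s / 2 + \<mu> s * \<theta> s) *\<^sub>R b s"
      using expand[of "vderiv k s"] unfolding kb' ke' kk' by (simp add: mult.commute)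
    with dk[OF s] show "(k has_vector_derivative
        (- \<theta> s) *\<^sub>R e s - \<mu> s *\<^sub>R k s + (vderiv \<theta> s / 2 + \<mu> s * \<theta> s) *\<^sub>R b s) (at s)" by simp
    have "vderiv b s = - e s + \<mu> s *\<^sub>R b s"
      using expand[of "vderiv b s"] unfolding be' bb' bk' by simp
    with db[OF s] show "(b has_vector_derivative - e s + \<mu> s *\<^sub>R b s) (at s)" by simp
  qed
  with frame show thesis unfolding e_def k_def by (rule that[rotated])
qed

section \<open>Existence of a curve with given invariants\<close>

text \<open>The factor \<open>\<langle>e \<times> k, b\<rangle>\<close> is the determinant of the frame. It is \<open>1\<close> or \<open>- 1\<close> by the Gram determinant,
  and is the sign of the curve.\<close>

lemma adapted_frame_cross:
  assumes "adapted_frame t e k b"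
  shows "lorentz_cross e k = \<langle>lorentz_cross e k, b\<rangle> *\<^sub>R (k - t *\<^sub>R b)"
proof -
  have "frame_transfer t e k b e k b (lorentz_cross e k) = lorentz_cross e k"
    using assms adapted_frame_iff_frame_transfer_id by blast
  then show ?thesis
    by (simp add: frame_transfer_def lorentz_cross_orthogonal algebra_simps)
qed

text \<open>The determinant of the frame is constant because the coefficient matrix of the frame equations has
  trace \<open>- \<mu> + \<mu> = 0\<close>.\<close>

lemma frame_orientation_constant:
  assumes "is_interval I" "frame_equations I \<theta> \<mu> e k b" "s \<in> I" "t \<in> I"
  shows "\<langle>lorentz_cross (e s) (k s), b s\<rangle> = \<langle>lorentz_cross (e t) (k t), b t\<rangle>"
proof (rule constant_if_derivative_zero[OF assms(1) _ assms(3,4)])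
  fix s assume s: "s \<in> I"
  let ?k' = "(- \<theta> s) *\<^sub>R e s - \<mu> s *\<^sub>R k s + (vderiv \<theta> s / 2 + \<mu> s * \<theta> s) *\<^sub>R b s"
  have d: "(e has_vector_derivative k s) (at s)" "(k has_vector_derivative ?k') (at s)"
      "(b has_vector_derivative - e s + \<mu> s *\<^sub>R b s) (at s)"
    using assms(2) s unfolding frame_equations_def by blast+
  have "\<langle>lorentz_cross (e s) (k s), - e s + \<mu> s *\<^sub>R b s\<rangle> +
      \<langle>lorentz_cross (e s) ?k' + lorentz_cross (k s) (k s), b s\<rangle> = 0"
    by (simp add: lorentz_cross.add_right lorentz_cross.diff_right lorentz_cross.scaleR_right
        lorentz_cross.minus_right lorentz_inner_bilinear_simps lorentz_cross_orthogonal lorentz_cross_self)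
  then show "((\<lambda>s. \<langle>lorentz_cross (e s) (k s), b s\<rangle>) has_vector_derivative 0) (at s)"
    using has_vector_derivative_lorentz_inner[OF lorentz_cross.has_vector_derivative[OF d(1,2)] d(3)]
    by simp
qed

lemma frame_equations_solution:
  fixes e0 k0 b0 :: "real^3"
  assumes I: "open I" "is_interval I" "s\<^sub>0 \<in> I" and \<theta>: "smooth_on I \<theta>" and \<mu>: "smooth_on I \<mu>"
  obtains e k b where "frame_equations I \<theta> \<mu> e k b"
    and "smooth_on I e" "smooth_on I k" "smooth_on I b"
    and "e s\<^sub>0 = e0" "k s\<^sub>0 = k0" "b s\<^sub>0 = b0"
proof -
  define \<nu> where "\<nu> s = (1/2) * vderiv \<theta> s + \<mu> s * \<theta> s" for s
  define K0 :: "((real^3) \<times> (real^3) \<times> (real^3)) \<Rightarrow>\<^sub>L ((real^3) \<times> (real^3) \<times> (real^3))"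
    where "K0 = Blinfun (\<lambda>v. (fst (snd v), 0, - fst v))"
  define K1 :: "((real^3) \<times> (real^3) \<times> (real^3)) \<Rightarrow>\<^sub>L ((real^3) \<times> (real^3) \<times> (real^3))"
    where "K1 = Blinfun (\<lambda>v. (0, - fst v, 0))"
  define K2 :: "((real^3) \<times> (real^3) \<times> (real^3)) \<Rightarrow>\<^sub>L ((real^3) \<times> (real^3) \<times> (real^3))"
    where "K2 = Blinfun (\<lambda>v. (0, - fst (snd v), snd (snd v)))"
  define K3 :: "((real^3) \<times> (real^3) \<times> (real^3)) \<Rightarrow>\<^sub>L ((real^3) \<times> (real^3) \<times> (real^3))"
    where "K3 = Blinfun (\<lambda>v. (0, snd (snd v), 0))"
  have K: "K0 v = (fst (snd v), 0, - fst v)" "K1 v = (0, - fst v, 0)"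
    "K2 v = (0, - fst (snd v), snd (snd v))" "K3 v = (0, snd (snd v), 0)" for v
    unfolding K0_def K1_def K2_def K3_def
    by (rule fun_cong[OF bounded_linear_Blinfun_apply], intro bounded_linear_intros bounded_linear_minus)+
  define A where "A s = K0 + \<theta> s *\<^sub>R K1 + \<mu> s *\<^sub>R K2 + \<nu> s *\<^sub>R K3" for s
  have \<nu>: "smooth_on I \<nu>"
    unfolding \<nu>_def
    by (intro smooth_on_add smooth_on_mult smooth_on_const smooth_on_vderiv I(1) \<theta> \<mu>)
  have A: "smooth_on I A"
    unfolding A_def
    by (intro smooth_on_add smooth_on_scaleR smooth_on_const I(1) \<theta> \<mu> \<nu>)
  obtain y where y0: "y s\<^sub>0 = (e0, k0, b0)"
    and y: "\<And>s. s \<in> I \<Longrightarrow> (y has_vector_derivative A s (y s)) (at s)"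
    using linear_ode_solution_exists[OF I smooth_on_continuous_on[OF A]] by blast
  have smooth: "smooth_on I y"
  proof (rule smooth_onI_bootstrap[OF I(1) y])
    fix n assume "times_differentiable_on n I y"
    then show "times_differentiable_on n I (\<lambda>s. A s (y s))"
      using A unfolding smooth_on_iff_times_differentiable_on
      by (intro times_differentiable_on_bilinear[OF I(1) bounded_bilinear_blinfun_apply]) auto
  qed
  have lin: "bounded_linear (\<lambda>v :: (real^3) \<times> (real^3) \<times> (real^3). fst v)"
    "bounded_linear (\<lambda>v :: (real^3) \<times> (real^3) \<times> (real^3). fst (snd v))"
    "bounded_linear (\<lambda>v :: (real^3) \<times> (real^3) \<times> (real^3). snd (snd v))"
    by (intro bounded_linear_intros)+
  show thesis
  proof (rule that)
    show "frame_equations I \<theta> \<mu> (\<lambda>s. fst (y s)) (\<lambda>s. fst (snd (y s))) (\<lambda>s. snd (snd (y s)))"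
      unfolding frame_equations_def
    proof (intro ballI conjI)
      fix s assume "s \<in> I"
      have Ay: "A s (y s) = (fst (snd (y s)),
          (- \<theta> s) *\<^sub>R fst (y s) - \<mu> s *\<^sub>R fst (snd (y s)) + \<nu> s *\<^sub>R snd (snd (y s)),
          - fst (y s) + \<mu> s *\<^sub>R snd (snd (y s)))"
        by (simp add: A_def K blinfun.add_left blinfun.scaleR_left)
      note d = lin[THEN bounded_linear.has_vector_derivative, OF y[OF \<open>s \<in> I\<close>]]
      show "((\<lambda>s. fst (y s)) has_vector_derivative fst (snd (y s))) (at s)"
        using d(1) by (simp add: Ay)
      show "((\<lambda>s. fst (snd (y s))) has_vector_derivative
          (- \<theta> s) *\<^sub>R fst (y s) - \<mu> s *\<^sub>R fst (snd (y s)) +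
          (vderiv \<theta> s / 2 + \<mu> s * \<theta> s) *\<^sub>R snd (snd (y s))) (at s)"
        using d(2) by (simp add: Ay \<nu>_def)
      show "((\<lambda>s. snd (snd (y s))) has_vector_derivative
          - fst (y s) + \<mu> s *\<^sub>R snd (snd (y s))) (at s)"
        using d(3) by (simp add: Ay)
    qed
  qed (use lin[THEN smooth_on_bounded_linear[OF I(1)]] smooth y0 in auto)
qed

lemma frame_equations_adapted:
  assumes "is_interval I" "smooth_on I \<theta>" "frame_equations I \<theta> \<mu> e k b" "s\<^sub>0 \<in> I"
    and "adapted_frame (\<theta> s\<^sub>0) (e s\<^sub>0) (k s\<^sub>0) (b s\<^sub>0)" and "s \<in> I"
  shows "adapted_frame (\<theta> s) (e s) (k s) (b s)"
  using frame_transfer_constant[OF assms(1,2,3,3,6,4)] assms(5)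
  unfolding adapted_frame_iff_frame_transfer_id by simp

text \<open>Integrate the first vector of a solution of the frame equations. The solution stays adapted, so the
  curve has unit speed, and \<open>\<langle>\<kappa>, \<beta>\<rangle> = 1\<close> keeps its curvature vector away from zero; the determinant stays
  \<open>1\<close>, so the third vector is the pseudo-binormal for the sign \<open>1\<close>.\<close>

lemma curve_exists:
  assumes I: "open I" "is_interval I" "s\<^sub>0 \<in> I"
    and \<theta>: "smooth_on I \<theta>" and \<mu>: "smooth_on I \<mu>"
    and zero: "\<And>s. s \<in> I \<Longrightarrow> \<theta> s = 0 \<longleftrightarrow> s = s\<^sub>0"
  shows "\<exists>\<gamma>. curve_with_invariants I s\<^sub>0 \<theta> \<mu> \<gamma>"
proof -
  \<comment> \<open>An adapted frame for \<open>t = 0\<close> with \<open>e \<times> k = k\<close>.\<close>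
  define e0 :: "real^3" where "e0 = vector [1, 0, 0]"
  define k0 :: "real^3" where "k0 = vector [0, 1, - 1]"
  define b0 :: "real^3" where "b0 = vector [0, 1/2, 1/2]"
  obtain e k b where eq: "frame_equations I \<theta> \<mu> e k b"
    and smooth: "smooth_on I e" "smooth_on I k" "smooth_on I b"
    and init: "e s\<^sub>0 = e0" "k s\<^sub>0 = k0" "b s\<^sub>0 = b0"
    by (rule frame_equations_solution[OF I \<theta> \<mu>])
  have "adapted_frame (\<theta> s\<^sub>0) (e s\<^sub>0) (k s\<^sub>0) (b s\<^sub>0)"
    using zero[OF I(3)]
    by (simp add: adapted_frame_def init e0_def k0_def b0_def lorentz_inner_def)
  from frame_equations_adapted[OF I(2) \<theta> eq I(3) this]
  have frame: "adapted_frame (\<theta> s) (e s) (k s) (b s)" if "s \<in> I" for s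
    using that .
  have "\<langle>lorentz_cross (e s\<^sub>0) (k s\<^sub>0), b s\<^sub>0\<rangle> = 1"
    by (simp add: init e0_def k0_def b0_def lorentz_inner_def lorentz_cross_components)
  then have cross: "lorentz_cross (e s) (k s) = k s - \<theta> s *\<^sub>R b s" if "s \<in> I" for s
    using adapted_frame_cross[OF frame[OF that]] frame_orientation_constant[OF I(2) eq that I(3)]
    by simp
  have gram: "\<langle>e s, e s\<rangle> = 1" "\<langle>e s, b s\<rangle> = 0" "\<langle>k s, k s\<rangle> = \<theta> s" "\<langle>k s, b s\<rangle> = 1" "\<langle>b s, b s\<rangle> = 0"
    if "s \<in> I" for s
    using frame[OF that] by (auto simp: adapted_frame_def)
  have k_nz: "k s \<noteq> 0" if "s \<in> I" for s
    using gram(4)[OF that] by (auto simp: lorentz_inner_bilinear_simps)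

  define \<gamma> where "\<gamma> = primitive_from s\<^sub>0 e"
  define k' where "k' s = (- \<theta> s) *\<^sub>R e s - \<mu> s *\<^sub>R k s + (vderiv \<theta> s / 2 + \<mu> s * \<theta> s) *\<^sub>R b s" for s
  have de: "(e has_vector_derivative k s) (at s)" and dk: "(k has_vector_derivative k' s) (at s)"
    if "s \<in> I" for s
    using eq that unfolding frame_equations_def k'_def by blast+
  have d\<gamma>: "(\<gamma> has_vector_derivative e s) (at s)" if "s \<in> I" for s
    unfolding \<gamma>_def
    by (rule has_vector_derivative_primitive_from[OF I smooth_on_continuous_on[OF smooth(1)] that])
  have \<gamma>_smooth: "smooth_on I \<gamma>"
    using smooth_onI_bootstrap[OF I(1) d\<gamma>] smooth(1)
    by (simp add: smooth_on_iff_times_differentiable_on)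
  have \<gamma>1: "vector_derivative \<gamma> (at s) = e s" if "s \<in> I" for s
    using vector_derivative_at[OF d\<gamma>[OF that]] .
  have \<gamma>2: "curvature_vector \<gamma> s = k s" if "s \<in> I" for s
    unfolding curvature_vector_def
    using vector_derivative_at[OF has_vector_derivative_transform_within_open[OF de[OF that] I(1) that]]
      \<gamma>1 by simp
  have \<gamma>3: "vector_derivative (curvature_vector \<gamma>) (at s) = k' s" if "s \<in> I" for s
    using vector_derivative_at[OF has_vector_derivative_transform_within_open[OF dk[OF that] I(1) that]]
      \<gamma>2 by simp
  have caus: "causal_curvature \<gamma> s = \<theta> s" if "s \<in> I" for s
    using gram that by (simp add: causal_curvature_def \<gamma>2)
  have "\<epsilon> = 1" if "\<epsilon> \<in> {1, - 1}" "k0 = \<epsilon> *\<^sub>R k0" for \<epsilon>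
    using that by (simp add: k0_def vec_eq_iff forall_3)
  then have sgn: "curvature_sign \<gamma> s\<^sub>0 = 1"
    using cross[OF I(3)] zero[OF I(3)] unfolding curvature_sign_def
    by (intro the_equality) (auto simp: \<gamma>1 \<gamma>2 I(3) init)
  have "is_pseudo_binormal I s\<^sub>0 \<gamma> b"
    using smooth(3) cross by (simp add: is_pseudo_binormal_def sgn \<gamma>1 \<gamma>2 caus)
  then have pb: "pseudo_binormal I s\<^sub>0 \<gamma> s = b s" if "s \<in> I" for s
    using that sgn caus zero by (intro pseudo_binormal_eq[OF I(1,3)]) auto
  have "pseudo_torsion I s\<^sub>0 \<gamma> s = \<mu> s" if "s \<in> I" for s
    using gram[OF that]
    by (simp add: pseudo_torsion_def pb \<gamma>3 that k'_def lorentz_inner_bilinear_simps)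
  moreover have "spacelike_curve I \<gamma>" "unit_speed I \<gamma>"
    using \<gamma>_smooth gram(1)
    by (force simp: spacelike_curve_def unit_speed_def spacelike_def \<gamma>1 lorentz_inner_bilinear_simps)+
  ultimately have "curve_with_invariants I s\<^sub>0 \<theta> \<mu> \<gamma>"
    using k_nz caus by (simp add: curve_with_invariants_def \<gamma>2)
  then show ?thesis by blast
qed

section \<open>Uniqueness up to isometry\<close>

lemma lorentz_inner_eq_inner: "\<langle>x, y\<rangle> = x \<bullet> (lorentz_Z *v y)"
  by (simp add: lorentz_inner_def lorentz_Z_def inner_vec_def matrix_vector_mult_def sum_3)

lemma isometric_matrix_in_O21:
  assumes "\<And>x y. \<langle>A *v x, A *v y\<rangle> = \<langle>x, y\<rangle>"
  shows "A \<in> O21"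
proof -
  have "x \<bullet> ((transpose A ** lorentz_Z ** A) *v y) = x \<bullet> (lorentz_Z *v y)" for x y
  proof -
    have "x \<bullet> ((transpose A ** lorentz_Z ** A) *v y) = x \<bullet> (transpose A *v (lorentz_Z *v (A *v y)))"
      by (simp only: matrix_vector_mul_assoc matrix_mul_assoc)
    also have "\<dots> = (A *v x) \<bullet> (lorentz_Z *v (A *v y))"
      using dot_lmul_matrix[of "lorentz_Z *v (A *v y)" A x] by (simp add: inner_commute)
    also have "\<dots> = x \<bullet> (lorentz_Z *v y)"
      using assms by (simp flip: lorentz_inner_eq_inner)
    finally show ?thesis .
  qed
  then have "(transpose A ** lorentz_Z ** A) *v y = lorentz_Z *v y" for y
    using vector_eq_ldot by blast
  then show ?thesis
    unfolding O21_def matrix_eq by simp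
qed

text \<open>The transfer map between the two frames is a fixed Lorentz transformation carrying the first
  velocity to the second; integrating the velocities adds a translation.\<close>

lemma curve_unique:
  assumes I: "open I" "is_interval I" "s\<^sub>0 \<in> I"
    and \<theta>: "smooth_on I \<theta>" and zero: "\<And>s. s \<in> I \<Longrightarrow> \<theta> s = 0 \<longleftrightarrow> s = s\<^sub>0"
    and curve: "curve_with_invariants I s\<^sub>0 \<theta> \<mu> \<gamma>\<^sub>1" "curve_with_invariants I s\<^sub>0 \<theta> \<mu> \<gamma>\<^sub>2"
  shows "\<exists>T. lorentz_isometry T \<and> (\<forall>s\<in>I. \<gamma>\<^sub>2 s = T (\<gamma>\<^sub>1 s))"
proof -
  obtain b\<^sub>1 where eq1: "frame_equations I \<theta> \<mu> (vderiv \<gamma>\<^sub>1) (curvature_vector \<gamma>\<^sub>1) b\<^sub>1"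
    and frame1: "\<And>s. s \<in> I \<Longrightarrow> adapted_frame (\<theta> s) (vderiv \<gamma>\<^sub>1 s) (curvature_vector \<gamma>\<^sub>1 s) (b\<^sub>1 s)"
    using curve_frame[OF I(1,3) zero \<theta> curve(1)] by blast
  obtain b\<^sub>2 where eq2: "frame_equations I \<theta> \<mu> (vderiv \<gamma>\<^sub>2) (curvature_vector \<gamma>\<^sub>2) b\<^sub>2"
    and frame2: "\<And>s. s \<in> I \<Longrightarrow> adapted_frame (\<theta> s) (vderiv \<gamma>\<^sub>2 s) (curvature_vector \<gamma>\<^sub>2 s) (b\<^sub>2 s)"
    using curve_frame[OF I(1,3) zero \<theta> curve(2)] by blast
  define L where "L s = frame_transfer (\<theta> s) (vderiv \<gamma>\<^sub>1 s) (curvature_vector \<gamma>\<^sub>1 s) (b\<^sub>1 s)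
    (vderiv \<gamma>\<^sub>2 s) (curvature_vector \<gamma>\<^sub>2 s) (b\<^sub>2 s)" for s
  have L_const: "L s x = L s\<^sub>0 x" if "s \<in> I" for s x
    unfolding L_def by (rule frame_transfer_constant[OF I(2) \<theta> eq1 eq2 that I(3)])
  have lin: "linear (L s\<^sub>0)"
    unfolding L_def by (rule frame_transfer_linear)
  have L_matrix: "matrix (L s\<^sub>0) *v x = L s\<^sub>0 x" for x
    by (rule fun_cong[OF matrix_vector_mul(2)[OF lin]])
  have in_O21: "matrix (L s\<^sub>0) \<in> O21"
  proof (rule isometric_matrix_in_O21)
    show "\<langle>matrix (L s\<^sub>0) *v x, matrix (L s\<^sub>0) *v y\<rangle> = \<langle>x, y\<rangle>" for x y
      unfolding L_matrix unfolding L_def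
      by (rule frame_transfer_isometric[OF frame1[OF I(3)] frame2[OF I(3)]])
  qed
  have diff: "\<gamma>\<^sub>2 s - L s\<^sub>0 (\<gamma>\<^sub>1 s) = \<gamma>\<^sub>2 s\<^sub>0 - L s\<^sub>0 (\<gamma>\<^sub>1 s\<^sub>0)" if "s \<in> I" for s
  proof (rule constant_if_derivative_zero[OF I(2) _ that I(3)])
    fix s assume s: "s \<in> I"
    have "smooth_on I \<gamma>\<^sub>1" "smooth_on I \<gamma>\<^sub>2"
      using curve by (auto simp: curve_with_invariants_def spacelike_curve_def)
    then have d: "(\<gamma>\<^sub>1 has_vector_derivative vderiv \<gamma>\<^sub>1 s) (at s)"
        "(\<gamma>\<^sub>2 has_vector_derivative vderiv \<gamma>\<^sub>2 s) (at s)"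
      using smooth_on_has_vector_derivative s by blast+
    have "L s\<^sub>0 (vderiv \<gamma>\<^sub>1 s) = vderiv \<gamma>\<^sub>2 s"
      using frame_transfer_maps_frame[OF frame1[OF s]] L_const[OF s] by (metis L_def)
    with has_vector_derivative_diff[OF d(2)
        bounded_linear.has_vector_derivative[OF linear_conv_bounded_linear[THEN iffD1, OF lin] d(1)]]
    show "((\<lambda>s. \<gamma>\<^sub>2 s - L s\<^sub>0 (\<gamma>\<^sub>1 s)) has_vector_derivative 0) (at s)" by simp
  qed
  let ?T = "\<lambda>x. matrix (L s\<^sub>0) *v x + (\<gamma>\<^sub>2 s\<^sub>0 - L s\<^sub>0 (\<gamma>\<^sub>1 s\<^sub>0))"
  have "lorentz_isometry ?T"
    unfolding lorentz_isometry_def using in_O21 by blast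
  moreover have "\<gamma>\<^sub>2 s = ?T (\<gamma>\<^sub>1 s)" if "s \<in> I" for s
    using diff[OF that] by (simp add: L_matrix algebra_simps)
  ultimately show ?thesis by blast
qed

theorem corollary3p6:
  fixes I :: "real set" and s\<^sub>0 :: real and \<theta> \<mu> :: "real \<Rightarrow> real"
  assumes "open I" and "is_interval I" and "s\<^sub>0 \<in> I"
    and "smooth_on I \<theta>" and "smooth_on I \<mu>"
    and "\<forall>s\<in>I. \<theta> s = 0 \<longleftrightarrow> s = s\<^sub>0"
  shows "(\<exists>\<gamma>. curve_with_invariants I s\<^sub>0 \<theta> \<mu> \<gamma>) \<and>
    (\<forall>\<gamma>\<^sub>1 \<gamma>\<^sub>2. curve_with_invariants I s\<^sub>0 \<theta> \<mu> \<gamma>\<^sub>1 \<longrightarrow> curve_with_invariants I s\<^sub>0 \<theta> \<mu> \<gamma>\<^sub>2 \<longrightarrow>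
      (\<exists>T. lorentz_isometry T \<and> (\<forall>s\<in>I. \<gamma>\<^sub>2 s = T (\<gamma>\<^sub>1 s))))"
  using curve_exists[OF assms(1-5)] curve_unique[OF assms(1-4)] assms(6) by blast

end
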